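(* Let $V:(0,\infty)\to\mathbb{R}$ be given by $$V(x)=\sum_{k=1}^\infty c_k e^{-i\phi_k x}\gamma_k(x),$$ with $c_k\in\mathbb{C}$, $\phi_k\in\mathbb{R}$, $\gamma_k:(0,\infty)\to\mathbb{C}$, and let $\eta\in(0,\infty)$, so that the following conditions hold: (i) the $\gamma_k$ are functions of bounded variation with $\sup_k\mathrm{Var}(\gamma_k,(0,\infty))<\infty$; (ii) for some $p\in\mathbb{Z}$, $p\ge2$, $\int_0^\infty\left(\sup_k|\gamma_k(x)|\right)^pdx<\infty$; (iii) $\sum_{k=1}^\infty|c_k|<\infty$; (iv) for $j=1,\dots,p-1$, $$\sum_{k_1,\dots,k_j=1}^\infty\left|c_{k_1}\cdots c_{k_j}\,h_j(\eta;\phi_{k_1},\dots,\phi_{k_j})\right|<\infty .$$ Then, for $E=\frac{\eta^2}{4}$, all solutions $u$ of $-u''(x)+V(x)u(x)=Eu(x)$ on $(0,\infty)$ are bounded.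
   Context: $\mathrm{Var}(\gamma,I)$ denotes the variation of $\gamma$ on the interval $I$. The functions $h_J$ of $1+J$ variables are defined recursively by $h_0(\eta)=1$ and, for $J\ge1$, $$h_J(\eta;\phi_1,\dots,\phi_J)=\frac1{\eta-\phi_1-\dots-\phi_J}\sum_{j=0}^{J-1}h_j(\eta;\phi_1,\dots,\phi_j)\,h_{J-j-1}(\eta;\phi_{j+1},\dots,\phi_{J-1}).$$ Condition (iv) is understood to include that the values $h_j(\eta;\phi_{k_1},\dots,\phi_{k_j})$ are finite (no vanishing denominators). Solutions $u$ are understood with $u,u'$ locally absolutely continuous (up to $0$), the equation holding almost everywhere. *)

theory Defs
  imports "HOL-Analysis.Analysis"
begin

definition variation :: "(real \<Rightarrow> 'a::real_normed_vector) \<Rightarrow> real set \<Rightarrow> ennreal" where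
  "variation f I =
     (SUP xs \<in> {xs. sorted xs \<and> set xs \<subseteq> I}.
        \<Sum>i<length xs - 1. ennreal (norm (f (xs ! Suc i) - f (xs ! i))))"

(* The arguments phi_1, ..., phi_J form the list phis, so phi_{i+1} = phis ! i.  For
   J = length phis and j < J, drop j (butlast phis) is (phi_{j+1}, ..., phi_{J-1}),
   which has length J - j - 1. *)
function h :: "real \<Rightarrow> real list \<Rightarrow> real" where
  "h \<eta> \<phi>s =
     (if \<phi>s = [] then 1
      else 1 / (\<eta> - sum_list \<phi>s) *
           (\<Sum>j<length \<phi>s. h \<eta> (take j \<phi>s) * h \<eta> (drop j (butlast \<phi>s))))"
  by pat_completeness auto
termination
  by (relation "Wellfounded.measure (\<lambda>(\<eta>, \<phi>s). length \<phi>s)") auto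

declare h.simps [simp del]

(* Division by zero yields 0 in HOL; h_finite says that no denominator vanishes
   anywhere in the recursion that computes h. *)
function h_finite :: "real \<Rightarrow> real list \<Rightarrow> bool" where
  "h_finite \<eta> \<phi>s \<longleftrightarrow>
     \<phi>s = [] \<or>
     (\<eta> - sum_list \<phi>s \<noteq> 0 \<and>
      (\<forall>j\<in>{..<length \<phi>s}. h_finite \<eta> (take j \<phi>s) \<and> h_finite \<eta> (drop j (butlast \<phi>s))))"
  by pat_completeness auto
termination
  by (relation "Wellfounded.measure (\<lambda>(\<eta>, \<phi>s). length \<phi>s)") auto

declare h_finite.simps [simp del]

definition abs_continuous_on :: "real set \<Rightarrow> (real \<Rightarrow> 'a::real_normed_vector) \<Rightarrow> bool" where
  "abs_continuous_on S f \<longleftrightarrow>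
     (\<forall>\<epsilon>>0. \<exists>\<delta>>0. \<forall>(n::nat) a b.
        (\<forall>i<n. a i \<le> b i \<and> {a i..b i} \<subseteq> S) \<longrightarrow>
        disjoint_family_on (\<lambda>i. {a i<..<b i}) {..<n} \<longrightarrow>
        (\<Sum>i<n. b i - a i) < \<delta> \<longrightarrow>
        (\<Sum>i<n. norm (f (b i) - f (a i))) < \<epsilon>)"

(* Locally absolutely continuous on (0,oo), up to the endpoint 0: f has an absolutely
   continuous extension to [0,b] for every b > 0.  The value f 0 plays no role. *)
definition loc_abs_continuous :: "(real \<Rightarrow> 'a::real_normed_vector) \<Rightarrow> bool" where
  "loc_abs_continuous f \<longleftrightarrow> (\<forall>b>0. abs_continuous_on {0<..b} f)"

definition is_solution :: "(real \<Rightarrow> real) \<Rightarrow> real \<Rightarrow> (real \<Rightarrow> complex) \<Rightarrow> bool" where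
  "is_solution V E u \<longleftrightarrow>
     (\<exists>u'. (\<forall>x>0. (u has_vector_derivative u' x) (at x)) \<and>
           loc_abs_continuous u \<and> loc_abs_continuous u' \<and>
           (AE x in lborel. x > 0 \<longrightarrow>
              (\<exists>u''. (u' has_vector_derivative u'') (at x) \<and>
                     - u'' + of_real (V x) * u x = of_real E * u x)))"

end

theory Submission
  imports Defs
begin

text \<open>Write a solution as the sum of two plane wave amplitudes \<open>A = (u - (2 * \<i> / \<eta>) * u') / 2\<close> and
  \<open>A' = (u + (2 * \<i> / \<eta>) * u') / 2\<close>. With \<open>W = V / \<eta>\<close>, the quotient \<open>r = A' / A\<close> satisfies the Riccati equation
  \<open>r' = - \<i> \<eta> r + \<i> W (1 + r)\<^sup>2\<close>, and the recursion for \<open>h\<close> is precisely the one for the formal power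
  series solution of that equation: if the \<open>\<gamma> k\<close> were constant, then \<open>1 + r\<close> would be the sum over all words
  \<open>k\<^sub>1 \<dots> k\<^sub>J\<close> of the products of the \<open>c k * \<gamma> k * exp (- \<i> * \<phi> k * x) / \<eta>\<close> with
  \<open>h \<eta> [\<phi> k\<^sub>1, \<dots>, \<phi> k\<^sub>J]\<close>. Cut off at words of length \<open>p - 1\<close>, the series leaves an error that consists of
  products of at least \<open>p\<close> of the \<open>\<gamma> k\<close>, which the \<open>p\<close>-th power condition makes integrable
  (\<open>reflection_deriv\<close>, \<open>sum_err_le\<close>).

  An exact solution \<open>r\<close> with \<open>|r| < 1\<close> yields a pair of complex conjugate solutions of the Schroedinger equation,
  because \<open>V\<close> is real, and the Wronskians of \<open>u\<close> with these two are constant. Hence a certain quadratic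
  form in \<open>u\<close> and \<open>u'\<close> with coefficients depending on \<open>r\<close>, called \<open>energy\<close> below, is conserved; it is
  comparable with \<open>|A|\<^sup>2 + |A'|\<^sup>2\<close> when \<open>|r| \<le> 1/2\<close>. For an approximate solution \<open>r\<close> the logarithmic derivative of
  the energy is bounded by a multiple of the residual of \<open>r\<close>. No resonant terms have to be examined one by one: their
  cancellation is contained in the conservation law (\<open>energy_derivative_identity\<close>, \<open>energy_step\<close>).

  The \<open>\<gamma> k\<close> are merely of bounded variation, so each is replaced on every interval from \<open>n\<close> to \<open>n + 1\<close> by its
  value at \<open>n\<close>. The replacement changes \<open>V\<close> by a function whose integral is controlled by the variation,
  and it makes \<open>r\<close> a smooth function on each interval that jumps at the integers, where the jumps are
  also summable by bounded variation (\<open>sum_jump_le\<close>). The energy therefore changes by a bounded factor in total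
  (\<open>bloch_vector_bounded\<close>). To keep all series finite only the first \<open>N\<close> of the \<open>\<gamma> k\<close> are used, with bounds that do
  not depend on \<open>N\<close>.

  Since \<open>u'\<close> is absolutely continuous and its derivative exists only almost everywhere, the differential
  inequality for the energy is integrated by means of \<open>abs_continuous_on_antimono\<close>.\<close>

section \<open>Absolutely continuous functions\<close>

lemma abs_continuous_on_finite_family:
  assumes "abs_continuous_on S f" "\<epsilon> > 0"
  shows "\<exists>\<delta>>0. \<forall>(I :: 'i set) a b. finite I \<longrightarrow> (\<forall>i\<in>I. a i \<le> b i \<and> {a i..b i} \<subseteq> S) \<longrightarrow>
       disjoint_family_on (\<lambda>i. {a i<..<b i}) I \<longrightarrow> (\<Sum>i\<in>I. b i - a i) < \<delta> \<longrightarrow>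
       (\<Sum>i\<in>I. norm (f (b i) - f (a i))) < \<epsilon>"
proof -
  obtain \<delta> where \<delta>: "\<delta> > 0" and D: "\<And>(n::nat) a b. (\<forall>i<n. a i \<le> b i \<and> {a i..b i} \<subseteq> S) \<Longrightarrow>
        disjoint_family_on (\<lambda>i. {a i<..<b i}) {..<n} \<Longrightarrow>
        (\<Sum>i<n. b i - a i) < \<delta> \<Longrightarrow> (\<Sum>i<n. norm (f (b i) - f (a i))) < \<epsilon>"
    using assms unfolding abs_continuous_on_def by blast
  show ?thesis
  proof (intro exI[of _ \<delta>] conjI allI impI \<delta>)
    fix I :: "'i set" and a b :: "'i \<Rightarrow> real"
    assume I: "finite I" "\<forall>i\<in>I. a i \<le> b i \<and> {a i..b i} \<subseteq> S"
      "disjoint_family_on (\<lambda>i. {a i<..<b i}) I" "(\<Sum>i\<in>I. b i - a i) < \<delta>"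
    \<comment> \<open>Enumerate the family, since the definition speaks of indices below a number.\<close>
    obtain e where e: "bij_betw e {..<card I} I"
      using ex_bij_betw_nat_finite[OF I(1)] by (auto simp: atLeast0LessThan)
    have "(\<Sum>i<card I. norm (f (b (e i)) - f (a (e i)))) < \<epsilon>"
    proof (rule D)
      show "\<forall>i<card I. a (e i) \<le> b (e i) \<and> {a (e i)..b (e i)} \<subseteq> S"
        using I(2) bij_betwE[OF e] by auto
      show "disjoint_family_on (\<lambda>i. {a (e i)<..<b (e i)}) {..<card I}"
        using I(3) bij_betwE[OF e] bij_betw_imp_inj_on[OF e]
        unfolding disjoint_family_on_def inj_on_def by blast
      show "(\<Sum>i<card I. b (e i) - a (e i)) < \<delta>"
        using I(4) by (subst sum.reindex_bij_betw[OF e, of "\<lambda>i. b i - a i"])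
    qed
    then show "(\<Sum>i\<in>I. norm (f (b i) - f (a i))) < \<epsilon>"
      by (subst (asm) sum.reindex_bij_betw[OF e, of "\<lambda>i. norm (f (b i) - f (a i))"])
  qed
qed

lemma abs_continuous_on_subset:
  "abs_continuous_on S f \<Longrightarrow> T \<subseteq> S \<Longrightarrow> abs_continuous_on T f"
  unfolding abs_continuous_on_def by (meson subset_trans)

text \<open>Sums, products, reciprocals, linear images and \<open>C\<^sup>1\<close> functions are all treated by this one
  comparison: the increments of the new function are dominated by those of two absolutely continuous
  ones.\<close>

lemma abs_continuous_on_dominated:
  fixes f :: "real \<Rightarrow> 'a::real_normed_vector" and g :: "real \<Rightarrow> 'b::real_normed_vector"
    and k :: "real \<Rightarrow> 'c::real_normed_vector"
  assumes f: "abs_continuous_on S f" and g: "abs_continuous_on S g"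
    and dom: "\<And>x y. x \<in> S \<Longrightarrow> y \<in> S \<Longrightarrow>
      norm (k y - k x) \<le> C * norm (f y - f x) + C * norm (g y - g x)"
  shows "abs_continuous_on S k"
  unfolding abs_continuous_on_def
proof (intro allI impI)
  fix \<epsilon> :: real assume \<epsilon>: "\<epsilon> > 0"
  define \<epsilon>' where "\<epsilon>' = \<epsilon> / (2 * (\<bar>C\<bar> + 1))"
  have \<epsilon>': "\<epsilon>' > 0" using \<epsilon> by (simp add: \<epsilon>'_def)
  obtain d1 where d1: "d1 > 0" "\<And>(n::nat) a b. (\<forall>i<n. a i \<le> b i \<and> {a i..b i} \<subseteq> S) \<Longrightarrow>
        disjoint_family_on (\<lambda>i. {a i<..<b i}) {..<n} \<Longrightarrow>
        (\<Sum>i<n. b i - a i) < d1 \<Longrightarrow> (\<Sum>i<n. norm (f (b i) - f (a i))) < \<epsilon>'"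
    using f \<epsilon>' unfolding abs_continuous_on_def by blast
  obtain d2 where d2: "d2 > 0" "\<And>(n::nat) a b. (\<forall>i<n. a i \<le> b i \<and> {a i..b i} \<subseteq> S) \<Longrightarrow>
        disjoint_family_on (\<lambda>i. {a i<..<b i}) {..<n} \<Longrightarrow>
        (\<Sum>i<n. b i - a i) < d2 \<Longrightarrow> (\<Sum>i<n. norm (g (b i) - g (a i))) < \<epsilon>'"
    using g \<epsilon>' unfolding abs_continuous_on_def by blast
  show "\<exists>\<delta>>0. \<forall>(n::nat) a b.
        (\<forall>i<n. a i \<le> b i \<and> {a i..b i} \<subseteq> S) \<longrightarrow>
        disjoint_family_on (\<lambda>i. {a i<..<b i}) {..<n} \<longrightarrow>
        (\<Sum>i<n. b i - a i) < \<delta> \<longrightarrow>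
        (\<Sum>i<n. norm (k (b i) - k (a i))) < \<epsilon>"
  proof (intro exI[of _ "min d1 d2"] conjI allI impI)
    fix n :: nat and a b :: "nat \<Rightarrow> real"
    assume n: "\<forall>i<n. a i \<le> b i \<and> {a i..b i} \<subseteq> S"
      "disjoint_family_on (\<lambda>i. {a i<..<b i}) {..<n}" "(\<Sum>i<n. b i - a i) < min d1 d2"
    have F: "(\<Sum>i<n. norm (f (b i) - f (a i))) < \<epsilon>'" and G: "(\<Sum>i<n. norm (g (b i) - g (a i))) < \<epsilon>'"
      using d1(2)[OF n(1,2)] d2(2)[OF n(1,2)] n(3) by auto
    have "(\<Sum>i<n. norm (k (b i) - k (a i)))
        \<le> (\<Sum>i<n. (\<bar>C\<bar> + 1) * norm (f (b i) - f (a i)) + (\<bar>C\<bar> + 1) * norm (g (b i) - g (a i)))"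
    proof (rule sum_mono)
      fix i assume "i \<in> {..<n}"
      then have "a i \<in> S" "b i \<in> S" using n(1) by (auto simp: subset_iff)
      from dom[OF this]
      show "norm (k (b i) - k (a i))
        \<le> (\<bar>C\<bar> + 1) * norm (f (b i) - f (a i)) + (\<bar>C\<bar> + 1) * norm (g (b i) - g (a i))"
        by (rule order_trans) (intro add_mono mult_right_mono, auto)
    qed
    also have "\<dots> = (\<bar>C\<bar> + 1) * (\<Sum>i<n. norm (f (b i) - f (a i)))
        + (\<bar>C\<bar> + 1) * (\<Sum>i<n. norm (g (b i) - g (a i)))"
      by (simp add: sum.distrib sum_distrib_left)
    also have "\<dots> < (\<bar>C\<bar> + 1) * \<epsilon>' + (\<bar>C\<bar> + 1) * \<epsilon>'"
      using F G by (intro add_strict_mono mult_strict_left_mono) auto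
    also have "\<dots> = \<epsilon>" unfolding \<epsilon>'_def using abs_ge_zero[of C] by (simp add: divide_simps)
    finally show "(\<Sum>i<n. norm (k (b i) - k (a i))) < \<epsilon>" .
  qed (use d1 d2 in auto)
qed

lemma abs_continuous_on_add:
  fixes f g :: "real \<Rightarrow> 'a::real_normed_vector"
  assumes "abs_continuous_on S f" "abs_continuous_on S g"
  shows "abs_continuous_on S (\<lambda>x. f x + g x)"
proof (rule abs_continuous_on_dominated[OF assms, where C = 1])
  fix x y
  have "norm ((f y - f x) + (g y - g x)) \<le> norm (f y - f x) + norm (g y - g x)"
    by (rule norm_triangle_ineq)
  then show "norm (f y + g y - (f x + g x)) \<le> 1 * norm (f y - f x) + 1 * norm (g y - g x)"
    by (simp add: algebra_simps)
qed

lemma abs_continuous_on_bounded_linear: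
  assumes "bounded_linear L" "abs_continuous_on S f"
  shows "abs_continuous_on S (\<lambda>x. L (f x))"
proof -
  interpret bounded_linear L by fact
  obtain K where K: "\<And>x. norm (L x) \<le> norm x * K" "K > 0" using pos_bounded by blast
  show ?thesis
  proof (rule abs_continuous_on_dominated[OF assms(2) assms(2), where C = K])
    fix x y
    have "norm (L (f y) - L (f x)) \<le> K * norm (f y - f x)"
      using K(1)[of "f y - f x"] by (simp add: diff mult.commute)
    then show "norm (L (f y) - L (f x)) \<le> K * norm (f y - f x) + K * norm (f y - f x)"
      using mult_nonneg_nonneg[OF less_imp_le[OF K(2)] norm_ge_zero[of "f y - f x"]] by linarith
  qed
qed

lemma abs_continuous_on_mult:
  fixes f g :: "real \<Rightarrow> 'a::real_normed_algebra"
  assumes f: "abs_continuous_on S f" and g: "abs_continuous_on S g"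
    and "bounded (f ` S)" "bounded (g ` S)"
  shows "abs_continuous_on S (\<lambda>x. f x * g x)"
proof -
  obtain A B where A: "\<And>x. x \<in> S \<Longrightarrow> norm (f x) \<le> A" and B: "\<And>x. x \<in> S \<Longrightarrow> norm (g x) \<le> B"
    using assms(3,4) unfolding bounded_iff by auto
  show ?thesis
  proof (rule abs_continuous_on_dominated[OF f g, where C = "max A B"])
    fix x y assume xy: "x \<in> S" "y \<in> S"
    have "f y * g y - f x * g x = (f y - f x) * g y + f x * (g y - g x)"
      by (simp add: algebra_simps)
    also have "norm \<dots> \<le> norm (f y - f x) * norm (g y) + norm (f x) * norm (g y - g x)"
      by (intro order_trans[OF norm_triangle_ineq] add_mono norm_mult_ineq)
    also have "\<dots> \<le> norm (f y - f x) * max A B + max A B * norm (g y - g x)"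
      using A[OF xy(1)] B[OF xy(2)] by (intro add_mono mult_left_mono mult_right_mono) auto
    finally show "norm (f y * g y - f x * g x)
        \<le> max A B * norm (f y - f x) + max A B * norm (g y - g x)"
      by (simp add: mult.commute)
  qed
qed

lemma abs_continuous_on_ident: "abs_continuous_on S (\<lambda>x::real. x)"
  unfolding abs_continuous_on_def
proof (intro allI impI)
  fix \<epsilon> :: real assume "\<epsilon> > 0"
  then show "\<exists>\<delta>>0. \<forall>(n::nat) a b. (\<forall>i<n. a i \<le> b i \<and> {a i..b i} \<subseteq> S) \<longrightarrow>
        disjoint_family_on (\<lambda>i. {a i<..<b i}) {..<n} \<longrightarrow>
        (\<Sum>i<n. b i - a i) < \<delta> \<longrightarrow> (\<Sum>i<n. norm (b i - a i)) < \<epsilon>"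
    by (intro exI[of _ \<epsilon>]) simp
qed

lemma abs_continuous_on_C1:
  fixes f :: "real \<Rightarrow> 'a::real_normed_vector"
  assumes "\<And>x. x \<in> {a..b} \<Longrightarrow> (f has_vector_derivative f' x) (at x within {a..b})"
    and "continuous_on {a..b} f'"
  shows "abs_continuous_on {a..b} f"
proof -
  have "bounded (f' ` {a..b})"
    using assms(2) compact_continuous_image compact_imp_bounded by blast
  then obtain B where B: "\<And>x. x \<in> {a..b} \<Longrightarrow> norm (f' x) \<le> B" unfolding bounded_iff by blast
  show ?thesis
  proof (rule abs_continuous_on_dominated[OF abs_continuous_on_ident abs_continuous_on_ident, where C = "\<bar>B\<bar>"])
    fix x y assume xy: "x \<in> {a..b}" "y \<in> {a..b}"
    have "norm (f y - f x) \<le> B * norm (y - x)"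
    proof (rule differentiable_bound[of "{a..b}" f "\<lambda>x h. h *\<^sub>R f' x"])
      fix t assume t: "t \<in> {a..b}"
      show "(f has_derivative (\<lambda>h. h *\<^sub>R f' t)) (at t within {a..b})"
        using assms(1)[OF t] by (simp add: has_vector_derivative_def)
      show "onorm (\<lambda>h. h *\<^sub>R f' t) \<le> B"
        using B[OF t] onorm_scaleR_left[OF bounded_linear_ident, of "f' t"] onorm_id[where 'a = real] by simp
    qed (use xy in auto)
    then show "norm (f y - f x) \<le> \<bar>B\<bar> * norm (y - x) + \<bar>B\<bar> * norm (y - x)"
      using mult_right_mono[OF abs_ge_self[of B] norm_ge_zero[of "y - x"]]
        mult_nonneg_nonneg[OF abs_ge_zero[of B] norm_ge_zero[of "y - x"]]
      by linarith
  qed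
qed

text \<open>The points where the derivative is missing are covered by an open set of small measure;
  absolute continuity makes the total increment over the tagged intervals around such points
  small.  Around all other points the increment is at most a small multiple of the length.\<close>

lemma abs_continuous_on_antimono:
  fixes f :: "real \<Rightarrow> real"
  assumes ac: "abs_continuous_on {a..b} f" and ab: "a \<le> b"
    and D: "AE x in lborel. x \<in> {a..b} \<longrightarrow> (\<exists>D\<le>0. (f has_vector_derivative D) (at x within {a..b}))"
  shows "f b \<le> f a"
proof (rule field_le_epsilon)
  fix e0 :: real assume "e0 > 0"
  define e where "e = e0 / (b - a + 1)"
  have e: "e > 0" unfolding e_def using \<open>e0 > 0\<close> ab by (intro divide_pos_pos) auto
  obtain \<delta> where \<delta>: "\<delta> > 0" and AC:
    "\<forall>(I :: (real \<times> real set) set) l r. finite I \<longrightarrow> (\<forall>i\<in>I. l i \<le> r i \<and> {l i..r i} \<subseteq> {a..b}) \<longrightarrow>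
       disjoint_family_on (\<lambda>i. {l i<..<r i}) I \<longrightarrow> (\<Sum>i\<in>I. r i - l i) < \<delta> \<longrightarrow>
       (\<Sum>i\<in>I. norm (f (r i) - f (l i))) < e"
    using abs_continuous_on_finite_family[OF ac e, where 'i = "real \<times> real set"] by (elim exE conjE) (rule that, assumption+)
  obtain N where N: "N \<in> null_sets lborel" and ND: "\<And>x. x \<in> {a..b} \<Longrightarrow> x \<notin> N \<Longrightarrow>
      \<exists>D\<le>0. (f has_vector_derivative D) (at x within {a..b})"
  proof -
    obtain N where N: "N \<in> null_sets lborel" "{x \<in> space lborel. \<not> (x \<in> {a..b} \<longrightarrow>
        (\<exists>D\<le>0. (f has_vector_derivative D) (at x within {a..b})))} \<subseteq> N"
      using D unfolding eventually_ae_filter by blast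
    show thesis by (rule that[OF N(1)]) (use N(2) in \<open>simp add: subset_iff, blast\<close>)
  qed
  have Nl: "N \<in> null_sets lebesgue" using N by (simp add: null_sets_completionI)
  obtain U where U: "open U" "N \<subseteq> U" "emeasure lebesgue U < ennreal \<delta>"
  proof -
    obtain T where T: "open T" "N \<subseteq> T" "(T - N) \<in> lmeasurable" "emeasure lebesgue (T - N) < ennreal \<delta>"
      using sets_lebesgue_outer_open[OF _ \<delta>, of N] Nl by (auto simp: null_sets_def)
    have "emeasure lebesgue T = emeasure lebesgue (T - N)"
      using emeasure_Diff_null_set[OF Nl] T(1) by (simp add: borel_open)
    then show thesis using that T by auto
  qed
  have near: "\<exists>d>0. \<forall>y\<in>{a..b}. \<bar>y - x\<bar> < d \<longrightarrow>
      (x \<le> y \<longrightarrow> f y - f x \<le> e * (y - x)) \<and> (y \<le> x \<longrightarrow> f x - f y \<le> e * (x - y))"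
    if x: "x \<in> {a..b}" "x \<notin> N" for x
  proof -
    obtain D where D: "D \<le> 0" "(f has_vector_derivative D) (at x within {a..b})"
      using ND[OF x] by auto
    then have "\<forall>e>0. \<exists>d>0. \<forall>y\<in>{a..b}. norm (y - x) < d \<longrightarrow>
        norm (f y - f x - (y - x) *\<^sub>R D) \<le> e * norm (y - x)"
      unfolding has_vector_derivative_def has_derivative_within_alt by blast
    then obtain d where d: "d > 0" "\<And>y. y \<in> {a..b} \<Longrightarrow> \<bar>y - x\<bar> < d \<Longrightarrow>
        \<bar>f y - f x - (y - x) * D\<bar> \<le> e * \<bar>y - x\<bar>"
      using e unfolding real_norm_def real_scaleR_def by meson
    show ?thesis
    proof (intro exI[of _ d] conjI ballI impI d(1))
      fix y assume y: "y \<in> {a..b}" "\<bar>y - x\<bar> < d"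
      have *: "\<bar>f y - f x - (y - x) * D\<bar> \<le> e * \<bar>y - x\<bar>" by (rule d(2)[OF y])
      show "f y - f x \<le> e * (y - x)" if "x \<le> y"
      proof -
        have "(y - x) * D \<le> 0" using that D(1) by (intro mult_nonneg_nonpos) auto
        moreover have eq: "\<bar>y - x\<bar> = y - x" using that by simp
        ultimately show ?thesis using *[unfolded eq] by linarith
      qed
      show "f x - f y \<le> e * (x - y)" if "y \<le> x"
      proof -
        have "0 \<le> (y - x) * D" using that D(1) by (intro mult_nonpos_nonpos) auto
        moreover have eq: "\<bar>y - x\<bar> = x - y" using that by simp
        ultimately show ?thesis using *[unfolded eq] by linarith
      qed
    qed
  qed
  \<comment> \<open>Around a point of the null set the gauge stays in the small open cover; around any other point
    it is so fine that the sign of the derivative controls the increment up to the slope \<open>e\<close>.\<close>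
  define good where "good x d \<longleftrightarrow> (x \<in> N \<longrightarrow> ball x d \<subseteq> U) \<and> (x \<in> {a..b} - N \<longrightarrow>
      (\<forall>y\<in>{a..b}. \<bar>y - x\<bar> < d \<longrightarrow>
        (x \<le> y \<longrightarrow> f y - f x \<le> e * (y - x)) \<and> (y \<le> x \<longrightarrow> f x - f y \<le> e * (x - y))))" for x d
  have "\<exists>d>0. good x d" for x
  proof (cases "x \<in> N")
    case True
    then obtain d where "d > 0" "ball x d \<subseteq> U" using U(1,2) open_contains_ball by blast
    then show ?thesis using True unfolding good_def by blast
  next
    case False
    then show ?thesis
      using near[of x] zero_less_one unfolding good_def by (cases "x \<in> {a..b}") blast+
  qed
  then obtain rad where rad0: "\<And>x. rad x > 0" and rad: "\<And>x. good x (rad x)" by metis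
  have "gauge (\<lambda>x. ball x (rad x))" using rad0 by (auto simp: gauge_def)
  then obtain P where P: "P tagged_division_of {a..b}" "(\<lambda>x. ball x (rad x)) fine P"
    by (rule fine_division_exists_real)
  have finP: "finite P" using P by auto
  have K: "Inf K \<le> x" "x \<le> Sup K" "a \<le> Inf K" "Sup K \<le> b" "K = {Inf K..Sup K}" "K \<subseteq> ball x (rad x)"
    if xKP: "(x, K) \<in> P" for x K
  proof -
    obtain l r where lr: "K = cbox l r" using tagged_division_ofD(4)[OF P(1) xKP] by auto
    have xK: "x \<in> K" "K \<subseteq> {a..b}" using tagged_division_ofD(2,3)[OF P(1) xKP] by auto
    then have "l \<le> r" using lr by auto
    then show "Inf K \<le> x" "x \<le> Sup K" "a \<le> Inf K" "Sup K \<le> b" "K = {Inf K..Sup K}" using xK lr by auto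
    show "K \<subseteq> ball x (rad x)" using P(2) xKP by (auto simp: fine_def)
  qed
  define P1 where "P1 = {z \<in> P. fst z \<in> N}"
  define P2 where "P2 = {z \<in> P. fst z \<notin> N}"
  have disj: "disjoint_family_on (\<lambda>z. {Inf (snd z)<..<Sup (snd z)}) P"
    unfolding disjoint_family_on_def
  proof (intro ballI impI)
    fix z w assume zw: "z \<in> P" "w \<in> P" "z \<noteq> w"
    obtain x X y Y where [simp]: "z = (x, X)" "w = (y, Y)" by (cases z; cases w)
    have "interior X \<inter> interior Y = {}" using tagged_division_ofD(5)[OF P(1)] zw by auto
    moreover have "interior X = {Inf X<..<Sup X}" "interior Y = {Inf Y<..<Sup Y}"
      using K(5)[of x X] K(5)[of y Y] zw interior_atLeastAtMost_real by (metis \<open>z = (x, X)\<close> \<open>w = (y, Y)\<close>)+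
    ultimately show "{Inf (snd z)<..<Sup (snd z)} \<inter> {Inf (snd w)<..<Sup (snd w)} = {}" by auto
  qed
  have sum2: "(\<Sum>z\<in>P2. f (Sup (snd z)) - f (Inf (snd z))) \<le> e * (b - a)"
  proof -
    have "(\<Sum>z\<in>P2. f (Sup (snd z)) - f (Inf (snd z))) \<le> (\<Sum>z\<in>P2. e * (Sup (snd z) - Inf (snd z)))"
    proof (rule sum_mono)
      fix z assume "z \<in> P2"
      then obtain x X where z: "z = (x, X)" "(x, X) \<in> P" "x \<notin> N" by (cases z) (auto simp: P2_def)
      note k = K[OF z(2)]
      have x: "x \<in> {a..b}" using k(1-4) by auto
      have ends: "t \<in> {a..b} \<and> \<bar>t - x\<bar> < rad x" if "t = Inf X \<or> t = Sup X" for t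
      proof -
        have "t \<in> {Inf X..Sup X}" using that k(1,2) by auto
        then have "t \<in> ball x (rad x)" using k(5,6) by blast
        then show ?thesis using that k(1-4) by (auto simp: dist_real_def)
      qed
      have "f (Sup X) - f x \<le> e * (Sup X - x)" "f x - f (Inf X) \<le> e * (x - Inf X)"
        using rad[of x] x z(3) k(1,2) ends[of "Inf X"] ends[of "Sup X"] unfolding good_def by blast+
      then show "f (Sup (snd z)) - f (Inf (snd z)) \<le> e * (Sup (snd z) - Inf (snd z))"
        by (simp add: z algebra_simps)
    qed
    also have "\<dots> \<le> (\<Sum>z\<in>P. e * (Sup (snd z) - Inf (snd z)))"
    proof (rule sum_mono2[OF finP])
      fix z assume "z \<in> P - P2"
      then show "0 \<le> e * (Sup (snd z) - Inf (snd z))" using K(1,2)[of "fst z" "snd z"] e by simp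
    qed (auto simp: P2_def)
    also have "\<dots> = e * (b - a)"
      using additive_tagged_division_1[OF ab P(1), of "\<lambda>x. x"]
      by (simp add: sum_distrib_left[symmetric] case_prod_beta)
    finally show ?thesis .
  qed
  have sum1: "(\<Sum>z\<in>P1. norm (f (Sup (snd z)) - f (Inf (snd z)))) < e"
  proof (rule AC[rule_format])
    show "finite P1" using finP by (simp add: P1_def)
    show "Inf (snd z) \<le> Sup (snd z) \<and> {Inf (snd z)..Sup (snd z)} \<subseteq> {a..b}" if "z \<in> P1" for z
      using K(1-4)[of "fst z" "snd z"] that by (auto simp: P1_def)
    show dj1: "disjoint_family_on (\<lambda>z. {Inf (snd z)<..<Sup (snd z)}) P1"
      using disj by (rule disjoint_family_on_mono[rotated]) (auto simp: P1_def)
    have le: "Inf (snd z) \<le> Sup (snd z)" if "z \<in> P1" for z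
      using K(1,2)[of "fst z" "snd z"] that by (auto simp: P1_def)
    have "ennreal (\<Sum>z\<in>P1. Sup (snd z) - Inf (snd z)) = (\<Sum>z\<in>P1. emeasure lebesgue {Inf (snd z)<..<Sup (snd z)})"
      using le by (subst sum_ennreal[symmetric]) auto
    also have "\<dots> = emeasure lebesgue (\<Union>z\<in>P1. {Inf (snd z)<..<Sup (snd z)})"
      using dj1 \<open>finite P1\<close> by (intro sum_emeasure) auto
    also have "\<dots> \<le> emeasure lebesgue U"
    proof (rule emeasure_mono)
      show "(\<Union>z\<in>P1. {Inf (snd z)<..<Sup (snd z)}) \<subseteq> U"
      proof safe
        fix x X t assume z: "(x, X) \<in> P1" and t: "t \<in> {Inf (snd (x, X))<..<Sup (snd (x, X))}"
        moreover have xX: "(x, X) \<in> P" using z by (simp add: P1_def)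
        ultimately have "t \<in> {Inf X..Sup X}" by simp
        then have "t \<in> X" using K(5)[OF xX] by blast
        then show "t \<in> U" using K(6)[OF xX] rad[of x] z unfolding P1_def good_def by auto
      qed
      show "U \<in> sets lebesgue" using U(1) by (simp add: borel_open)
    qed
    also have "\<dots> < ennreal \<delta>" by (rule U(3))
    finally show "(\<Sum>z\<in>P1. Sup (snd z) - Inf (snd z)) < \<delta>"
      using \<delta> by (simp add: ennreal_less_iff le sum_nonneg)
  qed
  have "P = P1 \<union> P2" "P1 \<inter> P2 = {}" by (auto simp: P1_def P2_def)
  then have "f b - f a = (\<Sum>z\<in>P1. f (Sup (snd z)) - f (Inf (snd z))) + (\<Sum>z\<in>P2. f (Sup (snd z)) - f (Inf (snd z)))"
    using additive_tagged_division_1[OF ab P(1), of f] finP by (simp add: case_prod_beta sum.union_disjoint)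
  moreover have "(\<Sum>z\<in>P1. f (Sup (snd z)) - f (Inf (snd z))) \<le> (\<Sum>z\<in>P1. norm (f (Sup (snd z)) - f (Inf (snd z))))"
    by (rule sum_mono) simp
  moreover have "e + e * (b - a) = e0"
    using ab by (simp add: e_def add_divide_distrib[symmetric] divide_simps) (simp add: algebra_simps)
  ultimately show "f b \<le> f a + e0" using sum1 sum2 by linarith
qed

lemma abs_continuous_on_imp_uniformly_continuous:
  assumes ac: "abs_continuous_on S f" and S: "is_interval S"
  shows "uniformly_continuous_on S f"
  unfolding uniformly_continuous_on_def
proof (intro allI impI)
  fix \<epsilon> :: real assume "0 < \<epsilon>"
  then obtain \<delta> where \<delta>: "\<delta> > 0" and D: "\<And>(n::nat) l r. (\<forall>i<n. l i \<le> r i \<and> {l i..r i} \<subseteq> S) \<Longrightarrow>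
        disjoint_family_on (\<lambda>i. {l i<..<r i}) {..<n} \<Longrightarrow>
        (\<Sum>i<n. r i - l i) < \<delta> \<Longrightarrow> (\<Sum>i<n. norm (f (r i) - f (l i))) < \<epsilon>"
    using ac unfolding abs_continuous_on_def by blast
  have one: "norm (f r - f l) < \<epsilon>" if "l \<le> r" "l \<in> S" "r \<in> S" "r - l < \<delta>" for l r
  proof -
    have "{l..r} \<subseteq> S" using mem_is_interval_1_I[OF S that(2,3)] by auto
    then show ?thesis
      using D[of 1 "\<lambda>_. l" "\<lambda>_. r"] that by (simp add: disjoint_family_on_def)
  qed
  show "\<exists>d>0. \<forall>x\<in>S. \<forall>x'\<in>S. dist x' x < d \<longrightarrow> dist (f x') (f x) < \<epsilon>"
  proof (intro exI[of _ \<delta>] conjI \<delta> ballI impI)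
    fix x y assume xy: "x \<in> S" "y \<in> S" "dist y x < \<delta>"
    show "dist (f y) (f x) < \<epsilon>"
    proof (cases "x \<le> y")
      case True
      then show ?thesis using one[of x y] xy by (simp add: dist_norm)
    next
      case False
      then show ?thesis using one[of y x] xy by (simp add: dist_norm norm_minus_commute)
    qed
  qed
qed

lemma abs_continuous_on_imp_continuous_on:
  "abs_continuous_on {a..b} f \<Longrightarrow> continuous_on {a..b} f"
  by (intro uniformly_continuous_imp_continuous abs_continuous_on_imp_uniformly_continuous is_interval_cc)

lemma abs_continuous_on_Ioc_bounded:
  fixes f :: "real \<Rightarrow> complex"
  assumes "abs_continuous_on {0<..b} f"
  shows "bounded (f ` {0<..b})"
proof (rule bounded_uniformly_continuous_image)
  show "uniformly_continuous_on {0<..b} f"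
    by (rule abs_continuous_on_imp_uniformly_continuous[OF assms is_interval_oc])
  show "bounded {0<..b}" by (rule bounded_subset[of "{0..b}"]) auto
qed

lemma abs_continuous_on_mult_interval:
  fixes f g :: "real \<Rightarrow> 'a::real_normed_algebra"
  assumes f: "abs_continuous_on {a..b} f" and g: "abs_continuous_on {a..b} g"
  shows "abs_continuous_on {a..b} (\<lambda>x. f x * g x)"
  by (intro abs_continuous_on_mult f g compact_imp_bounded compact_continuous_image
      abs_continuous_on_imp_continuous_on compact_Icc)

lemma abs_continuous_on_cmult:
  fixes f :: "real \<Rightarrow> 'a::real_normed_algebra"
  shows "abs_continuous_on S f \<Longrightarrow> abs_continuous_on S (\<lambda>x. c * f x)"
  by (rule abs_continuous_on_bounded_linear[OF bounded_linear_mult_right])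

lemma abs_continuous_on_diff:
  fixes f g :: "real \<Rightarrow> 'a::real_normed_vector"
  assumes "abs_continuous_on S f" "abs_continuous_on S g"
  shows "abs_continuous_on S (\<lambda>x. f x - g x)"
  using abs_continuous_on_add[OF assms(1)
      abs_continuous_on_bounded_linear[OF bounded_linear_minus[OF bounded_linear_ident] assms(2)]] by simp

lemma abs_continuous_on_const: "abs_continuous_on S (\<lambda>_. c)"
  unfolding abs_continuous_on_def using zero_less_one by (auto simp del: zero_less_one)

lemma abs_continuous_on_inverse:
  fixes f :: "real \<Rightarrow> real"
  assumes f: "abs_continuous_on S f" and m: "m > 0" "\<And>x. x \<in> S \<Longrightarrow> m \<le> f x"
  shows "abs_continuous_on S (\<lambda>x. 1 / f x)"
proof (rule abs_continuous_on_dominated[OF f f, where C = "1 / m\<^sup>2"])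
  fix x y assume xy: "x \<in> S" "y \<in> S"
  have pos: "f x > 0" "f y > 0" using m xy by (metis less_le_trans)+
  have "m\<^sup>2 \<le> f y * f x" unfolding power2_eq_square
    using m(1) m(2)[OF xy(1)] m(2)[OF xy(2)] by (intro mult_mono) auto
  have "norm (1 / f y - 1 / f x) = \<bar>f y - f x\<bar> / (f y * f x)"
  proof -
    have "1 / f y - 1 / f x = (f x - f y) / (f y * f x)" using pos by (simp add: field_simps)
    then show ?thesis using pos by (simp add: abs_mult abs_minus_commute)
  qed
  also have "\<dots> \<le> \<bar>f y - f x\<bar> / m\<^sup>2"
    using \<open>m\<^sup>2 \<le> f y * f x\<close> m(1) pos by (intro divide_left_mono) auto
  finally show "norm (1 / f y - 1 / f x) \<le> 1 / m\<^sup>2 * norm (f y - f x) + 1 / m\<^sup>2 * norm (f y - f x)"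
    using m(1) by (simp add: divide_right_mono add_increasing2)
qed

section \<open>The truncated Riccati series\<close>

text \<open>The functions of this section are built from finitely many frequencies \<open>\<phi> k\<close>, \<open>k < N\<close>, with
  constant coefficients \<open>z k\<close>: on a unit interval these stand for the frozen potential. All sums are
  finite, so they can be differentiated term by term.\<close>

definition words :: "nat \<Rightarrow> nat \<Rightarrow> nat list set" where
  "words N J = {ks. set ks \<subseteq> {..<N} \<and> length ks = J}"

definition wave :: "(nat \<Rightarrow> real) \<Rightarrow> (nat \<Rightarrow> complex) \<Rightarrow> nat \<Rightarrow> real \<Rightarrow> complex" where
  "wave \<phi> z N x = (\<Sum>k<N. z k * exp (- \<i> * of_real (\<phi> k) * of_real x))"

text \<open>The part of degree \<open>J\<close> of the formal power series solution, in powers of the potential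
  \<open>w = wave \<phi> z N\<close>, of the Riccati equation \<open>H' = - \<i> \<eta> (H - 1) + \<i> w H\<^sup>2\<close>.\<close>

definition h_wave ::
  "real \<Rightarrow> (nat \<Rightarrow> real) \<Rightarrow> (nat \<Rightarrow> complex) \<Rightarrow> nat \<Rightarrow> nat \<Rightarrow> real \<Rightarrow> complex" where
  "h_wave \<eta> \<phi> z N J x = (\<Sum>ks\<in>words N J. prod_list (map z ks) * of_real (h \<eta> (map \<phi> ks)) *
     exp (- \<i> * of_real (sum_list (map \<phi> ks)) * of_real x))"

text \<open>Truncating the series at degree \<open>p - 1\<close> and dropping the constant \<open>1\<close> gives an approximate
  solution of \<open>r' = - \<i> \<eta> r + \<i> w (1 + r)\<^sup>2\<close>, the equation for the quotient of the two plane wave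
  amplitudes of a solution of the Schroedinger equation. The error consists of the terms of
  \<open>w (1 + r)\<^sup>2\<close> of degree at least \<open>p\<close>.\<close>

definition reflection ::
  "real \<Rightarrow> (nat \<Rightarrow> real) \<Rightarrow> (nat \<Rightarrow> complex) \<Rightarrow> nat \<Rightarrow> nat \<Rightarrow> real \<Rightarrow> complex" where
  "reflection \<eta> \<phi> z N p x = (\<Sum>J=1..p-1. h_wave \<eta> \<phi> z N J x)"

definition reflection_error ::
  "real \<Rightarrow> (nat \<Rightarrow> real) \<Rightarrow> (nat \<Rightarrow> complex) \<Rightarrow> nat \<Rightarrow> nat \<Rightarrow> real \<Rightarrow> complex" where
  "reflection_error \<eta> \<phi> z N p x = wave \<phi> z N x *
     (\<Sum>(j,l)\<in>{(j,l). j < p \<and> l < p \<and> p - 1 \<le> j + l}. h_wave \<eta> \<phi> z N j x * h_wave \<eta> \<phi> z N l x)"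

lemma finite_words [simp]: "finite (words N J)"
  unfolding words_def by (intro finite_lists_length_eq finite_lessThan)

lemma words_0 [simp]: "words N 0 = {[]}"
  by (auto simp: words_def)

lemma h_Nil [simp]: "h \<eta> [] = 1"
  by (subst h.simps) simp

lemma h_wave_0 [simp]: "h_wave \<eta> \<phi> z N 0 x = 1"
  by (simp add: h_wave_def)

lemma h_recursion:
  assumes "\<phi>s \<noteq> []" "\<eta> - sum_list \<phi>s \<noteq> 0"
  shows "(\<eta> - sum_list \<phi>s) * h \<eta> \<phi>s =
    (\<Sum>j<length \<phi>s. h \<eta> (take j \<phi>s) * h \<eta> (drop j (butlast \<phi>s)))"
  using assms by (subst h.simps) simp

text \<open>A word of length \<open>J\<close> is the same as its first \<open>j\<close> letters, its last letter and the \<open>J - 1 - j\<close>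
  letters in between. This is the shape of the recursion for \<open>h\<close>; it turns the sum over words into a
  product of three sums.\<close>

lemma sum_words_split:
  fixes F :: "nat list \<Rightarrow> nat list \<Rightarrow> nat \<Rightarrow> complex"
  assumes "j < J"
  shows "(\<Sum>ks\<in>words N J. F (take j ks) (drop j (butlast ks)) (last ks)) =
    (\<Sum>k<N. \<Sum>as\<in>words N j. \<Sum>bs\<in>words N (J - 1 - j). F as bs k)"
proof -
  have "(\<Sum>k<N. \<Sum>as\<in>words N j. \<Sum>bs\<in>words N (J - 1 - j). F as bs k)
      = (\<Sum>(k, as, bs)\<in>{..<N} \<times> words N j \<times> words N (J - 1 - j). F as bs k)"
    by (simp add: sum.cartesian_product)
  also have "\<dots> = (\<Sum>ks\<in>words N J. F (take j ks) (drop j (butlast ks)) (last ks))"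
  proof (rule sum.reindex_bij_witness[of _ "\<lambda>ks. (last ks, take j ks, drop j (butlast ks))"
        "\<lambda>(k, as, bs). as @ bs @ [k]"])
    fix w assume w: "w \<in> {..<N} \<times> words N j \<times> words N (J - 1 - j)"
    then obtain k as bs where w': "w = (k, as, bs)" "k < N" "as \<in> words N j" "bs \<in> words N (J - 1 - j)"
      by auto
    then show "(last (case w of (k, as, bs) \<Rightarrow> as @ bs @ [k]), take j (case w of (k, as, bs) \<Rightarrow> as @ bs @ [k]),
        drop j (butlast (case w of (k, as, bs) \<Rightarrow> as @ bs @ [k]))) = w"
      by (auto simp: words_def butlast_append)
    show "(case w of (k, as, bs) \<Rightarrow> as @ bs @ [k]) \<in> words N J"
      using w' assms by (auto simp: words_def)
    show "F (take j (case w of (k, as, bs) \<Rightarrow> as @ bs @ [k])) (drop j (butlast (case w of (k, as, bs) \<Rightarrow> as @ bs @ [k])))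
        (last (case w of (k, as, bs) \<Rightarrow> as @ bs @ [k])) = (case w of (k, as, bs) \<Rightarrow> F as bs k)"
      using w' by (auto simp: words_def butlast_append)
  next
    fix ks assume ks: "ks \<in> words N J"
    then have len: "length ks = J" "ks \<noteq> []" using assms by (auto simp: words_def)
    have "take j ks @ drop j (butlast ks) @ [last ks] = ks"
    proof -
      have "take j ks = take j (butlast ks)" using assms len by (simp add: take_butlast)
      then show ?thesis using len by (metis append.assoc append_butlast_last_id append_take_drop_id)
    qed
    then show "(case (last ks, take j ks, drop j (butlast ks)) of (k, as, bs) \<Rightarrow> as @ bs @ [k]) = ks"
      by simp
    have "set ks \<subseteq> {..<N}" using ks by (simp add: words_def)
    then show "(last ks, take j ks, drop j (butlast ks)) \<in> {..<N} \<times> words N j \<times> words N (J - 1 - j)"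
      using len assms by (auto simp: words_def dest!: in_set_takeD in_set_dropD in_set_butlastD intro!: last_in_set)
  qed
  finally show ?thesis by simp
qed

text \<open>Differentiating a term with frequencies \<open>\<phi>s\<close> multiplies it by
  \<open>- \<i> (sum_list \<phi>s) = - \<i> \<eta> + \<i> (\<eta> - sum_list \<phi>s)\<close>; the second factor
  is the denominator in the recursion for \<open>h\<close>, and so it produces the convolution.\<close>

lemma h_wave_deriv:
  assumes J: "J \<ge> 1" and nz: "\<And>ks. ks \<in> words N J \<Longrightarrow> \<eta> - sum_list (map \<phi> ks) \<noteq> 0"
  shows "(h_wave \<eta> \<phi> z N J has_vector_derivative
     - \<i> * of_real \<eta> * h_wave \<eta> \<phi> z N J x +
     \<i> * wave \<phi> z N x * (\<Sum>j<J. h_wave \<eta> \<phi> z N j x * h_wave \<eta> \<phi> z N (J - 1 - j) x)) (at x)"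
proof -
  define e where "e k = z k * exp (- \<i> * of_real (\<phi> k) * of_real x)" for k
  have e_prod: "prod_list (map e ks) =
      prod_list (map z ks) * exp (- \<i> * of_real (sum_list (map \<phi> ks)) * of_real x)" for ks
    by (induction ks) (simp_all add: e_def algebra_simps exp_add[symmetric] flip: exp_add)
  define G where "G ks = prod_list (map e ks) * of_real (h \<eta> (map \<phi> ks))" for ks
  have HG: "h_wave \<eta> \<phi> z N j x = (\<Sum>ks\<in>words N j. G ks)" for j
    unfolding h_wave_def G_def e_prod by (intro sum.cong refl) (simp add: mult_ac)
  have D: "(h_wave \<eta> \<phi> z N J has_vector_derivative
     (\<Sum>ks\<in>words N J. - \<i> * of_real (sum_list (map \<phi> ks)) * G ks)) (at x)"
  proof -
    have E: "((\<lambda>x. c * exp (- \<i> * of_real s * of_real x)) has_vector_derivative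
        (c * (- \<i> * of_real s * exp (- \<i> * of_real s * of_real x)))) (at x)" for c :: complex and s
      by (intro has_vector_derivative_mult_right has_vector_derivative_real_field[where f = "\<lambda>w. exp (- \<i> * of_real s * w)"])
         (auto intro!: derivative_eq_intros)
    have "((\<lambda>x. \<Sum>ks\<in>words N J. prod_list (map z ks) * of_real (h \<eta> (map \<phi> ks)) *
          exp (- \<i> * of_real (sum_list (map \<phi> ks)) * of_real x)) has_vector_derivative
        (\<Sum>ks\<in>words N J. prod_list (map z ks) * of_real (h \<eta> (map \<phi> ks)) *
          (- \<i> * of_real (sum_list (map \<phi> ks)) * exp (- \<i> * of_real (sum_list (map \<phi> ks)) * of_real x)))) (at x)"
      by (rule has_vector_derivative_sum) (rule E)
    then show ?thesis
      unfolding h_wave_def G_def e_prod by (simp add: mult_ac)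
  qed
  have key: "of_real (\<eta> - sum_list (map \<phi> ks)) * G ks =
      (\<Sum>j<J. e (last ks) * G (take j ks) * G (drop j (butlast ks)))" if ks: "ks \<in> words N J" for ks
  proof -
    have len: "length ks = J" "ks \<noteq> []" using ks J by (auto simp: words_def)
    have "complex_of_real (\<eta> - sum_list (map \<phi> ks)) * G ks = prod_list (map e ks) *
        of_real ((\<eta> - sum_list (map \<phi> ks)) * h \<eta> (map \<phi> ks))"
      unfolding G_def by simp
    also have "(\<eta> - sum_list (map \<phi> ks)) * h \<eta> (map \<phi> ks) =
        (\<Sum>j<J. h \<eta> (map \<phi> (take j ks)) * h \<eta> (map \<phi> (drop j (butlast ks))))"
      using h_recursion[of "map \<phi> ks" \<eta>] nz[OF ks] len
      unfolding map_butlast[symmetric] take_map drop_map by simp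
    also have "prod_list (map e ks) * of_real \<dots> = (\<Sum>j<J. prod_list (map e ks) *
        (of_real (h \<eta> (map \<phi> (take j ks))) * of_real (h \<eta> (map \<phi> (drop j (butlast ks))))))"
      by (simp add: sum_distrib_left)
    also have "\<dots> = (\<Sum>j<J. e (last ks) * G (take j ks) * G (drop j (butlast ks)))"
    proof (rule sum.cong[OF refl])
      fix j assume "j \<in> {..<J}"
      then have "take j ks = take j (butlast ks)" using len by (simp add: take_butlast)
      then have ks': "take j ks @ drop j (butlast ks) @ [last ks] = ks"
        using len by (metis append.assoc append_butlast_last_id append_take_drop_id)
      have "prod_list (map e (take j ks @ drop j (butlast ks) @ [last ks])) =
          prod_list (map e (take j ks)) * (prod_list (map e (drop j (butlast ks))) * e (last ks))"
        by simp
      then have "prod_list (map e ks) =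
          prod_list (map e (take j ks)) * (prod_list (map e (drop j (butlast ks))) * e (last ks))"
        unfolding ks' .
      then show "prod_list (map e ks) *
        (of_real (h \<eta> (map \<phi> (take j ks))) * of_real (h \<eta> (map \<phi> (drop j (butlast ks))))) =
        e (last ks) * G (take j ks) * G (drop j (butlast ks))"
        by (simp add: G_def mult_ac)
    qed
    finally show ?thesis .
  qed
  have conv: "(\<Sum>ks\<in>words N J. e (last ks) * G (take j ks) * G (drop j (butlast ks))) =
      wave \<phi> z N x * (h_wave \<eta> \<phi> z N j x * h_wave \<eta> \<phi> z N (J - 1 - j) x)" if "j < J" for j
  proof -
    have "(\<Sum>ks\<in>words N J. e (last ks) * G (take j ks) * G (drop j (butlast ks)))
        = (\<Sum>k<N. \<Sum>as\<in>words N j. \<Sum>bs\<in>words N (J - 1 - j). e k * G as * G bs)"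
      by (rule sum_words_split[OF that, where F = "\<lambda>as bs k. e k * G as * G bs"])
    also have "\<dots> = (\<Sum>k<N. e k) * ((\<Sum>as\<in>words N j. G as) * (\<Sum>bs\<in>words N (J - 1 - j). G bs))"
      by (simp only: sum_product) (simp only: sum_distrib_left mult.assoc)
    finally show ?thesis by (simp add: HG wave_def e_def)
  qed
  have "(\<Sum>ks\<in>words N J. - \<i> * of_real (sum_list (map \<phi> ks)) * G ks) =
      (\<Sum>ks\<in>words N J. - \<i> * of_real \<eta> * G ks + \<i> * (of_real (\<eta> - sum_list (map \<phi> ks)) * G ks))"
    by (intro sum.cong refl) (simp add: algebra_simps)
  also have "\<dots> = - \<i> * of_real \<eta> * h_wave \<eta> \<phi> z N J x +
      \<i> * (\<Sum>ks\<in>words N J. \<Sum>j<J. e (last ks) * G (take j ks) * G (drop j (butlast ks)))"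
  proof -
    have "(\<Sum>ks\<in>words N J. of_real (\<eta> - sum_list (map \<phi> ks)) * G ks) =
        (\<Sum>ks\<in>words N J. \<Sum>j<J. e (last ks) * G (take j ks) * G (drop j (butlast ks)))"
      by (intro sum.cong refl key)
    then show ?thesis by (simp only: sum.distrib sum_distrib_left[symmetric] HG)
  qed
  also have "(\<Sum>ks\<in>words N J. \<Sum>j<J. e (last ks) * G (take j ks) * G (drop j (butlast ks))) =
      wave \<phi> z N x * (\<Sum>j<J. h_wave \<eta> \<phi> z N j x * h_wave \<eta> \<phi> z N (J - 1 - j) x)"
    by (subst sum.swap) (simp add: conv sum_distrib_left)
  finally show ?thesis using D by (simp add: mult.assoc)
qed

text \<open>In \<open>w (1 + r)\<^sup>2\<close> the products \<open>H\<^sub>j H\<^sub>l\<close> with \<open>j + l < p - 1\<close> are exactly those that the derivatives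
  of the parts of degree below \<open>p\<close> produce; all others are collected in the error.\<close>

lemma reflection_deriv:
  assumes p: "p \<ge> 1"
    and nz: "\<And>J ks. J \<in> {1..p-1} \<Longrightarrow> ks \<in> words N J \<Longrightarrow> \<eta> - sum_list (map \<phi> ks) \<noteq> 0"
  shows "(reflection \<eta> \<phi> z N p has_vector_derivative
     - \<i> * of_real \<eta> * reflection \<eta> \<phi> z N p x + \<i> * wave \<phi> z N x * (1 + reflection \<eta> \<phi> z N p x)\<^sup>2
     - \<i> * reflection_error \<eta> \<phi> z N p x) (at x)"
proof -
  define H where "H j = h_wave \<eta> \<phi> z N j x" for j
  define W where "W = wave \<phi> z N x"
  have D: "(reflection \<eta> \<phi> z N p has_vector_derivative
     (\<Sum>J=1..p-1. - \<i> * of_real \<eta> * H J + \<i> * W * (\<Sum>j<J. H j * H (J - 1 - j)))) (at x)"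
    unfolding reflection_def H_def W_def
    by (rule has_vector_derivative_sum) (rule h_wave_deriv, use nz in auto)
  have tri: "(\<Sum>J=1..p-1. \<Sum>j<J. H j * H (J - 1 - j)) = (\<Sum>(j,l)\<in>{(j,l). j + l < p - 1}. H j * H l)"
  proof -
    have "(\<Sum>J=1..p-1. \<Sum>j<J. H j * H (J - 1 - j)) = (\<Sum>k<p-1. \<Sum>j<Suc k. H j * H (k - j))"
      by (rule sum.reindex_bij_witness[of _ Suc "\<lambda>J. J - 1"]) auto
    then show ?thesis by (simp add: sum.triangle_reindex lessThan_Suc_atMost)
  qed
  have R: "1 + reflection \<eta> \<phi> z N p x = (\<Sum>j<p. H j)"
  proof -
    have "{..<p} = insert 0 {1..p-1}" using p by auto
    then show ?thesis by (simp add: reflection_def H_def)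
  qed
  have "(\<Sum>j<p. H j)\<^sup>2 = (\<Sum>(j,l)\<in>{..<p} \<times> {..<p}. H j * H l)"
    by (simp add: power2_eq_square sum_product sum.cartesian_product)
  also have "{..<p} \<times> {..<p} = {(j,l). j + l < p - 1} \<union> {(j,l). j < p \<and> l < p \<and> p - 1 \<le> j + l}"
    by auto
  also have "(\<Sum>(j,l)\<in>\<dots>. H j * H l) = (\<Sum>(j,l)\<in>{(j,l). j + l < p - 1}. H j * H l)
      + (\<Sum>(j,l)\<in>{(j,l). j < p \<and> l < p \<and> p - 1 \<le> j + l}. H j * H l)"
    by (rule sum.union_disjoint)
       (auto intro: finite_subset[of _ "{..<p} \<times> {..<p}"])
  finally have sq: "(\<Sum>j<p. H j)\<^sup>2 = (\<Sum>J=1..p-1. \<Sum>j<J. H j * H (J - 1 - j))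
      + (\<Sum>(j,l)\<in>{(j,l). j < p \<and> l < p \<and> p - 1 \<le> j + l}. H j * H l)"
    unfolding tri .
  have "(\<Sum>J=1..p-1. - \<i> * of_real \<eta> * H J + \<i> * W * (\<Sum>j<J. H j * H (J - 1 - j))) =
     - \<i> * of_real \<eta> * reflection \<eta> \<phi> z N p x + \<i> * W * (\<Sum>J=1..p-1. \<Sum>j<J. H j * H (J - 1 - j))"
    unfolding reflection_def H_def[symmetric] sum.distrib sum_distrib_left ..
  also have "\<dots> = - \<i> * of_real \<eta> * reflection \<eta> \<phi> z N p x + \<i> * W * (1 + reflection \<eta> \<phi> z N p x)\<^sup>2
     - \<i> * reflection_error \<eta> \<phi> z N p x"
  proof -
    have "r + \<i> * W * A = r + \<i> * W * (A + B) - \<i> * (W * B)" for r A B :: complex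
      by (simp add: algebra_simps)
    then show ?thesis unfolding R sq reflection_error_def H_def W_def .
  qed
  finally show ?thesis using D by (simp add: W_def)
qed

section \<open>An almost conserved quadratic form\<close>

text \<open>Let \<open>A\<close> and \<open>A'\<close> be the two plane wave amplitudes of a solution. With \<open>T = |A|\<^sup>2 + |A'|\<^sup>2\<close> and
  \<open>X + \<i> Y = cnj A * A'\<close> the quantity below is
  \<open>(|A - cnj r * A'|\<^sup>2 + |A' - r * A|\<^sup>2) / (1 - |r|\<^sup>2)\<close>. If \<open>r\<close> solves the Riccati equation exactly, then
  the summands are, up to constant factors, the squared moduli of the Wronskians of the solution with
  the solution of amplitude quotient \<open>r\<close> and with the conjugate of that solution; hence it is a constant
  of motion.\<close>

definition energy :: "real \<Rightarrow> real \<Rightarrow> real \<Rightarrow> complex \<Rightarrow> real" where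
  "energy T X Y r = ((1 + (cmod r)\<^sup>2) * T - 4 * (Re r * X + Im r * Y)) / (1 - (cmod r)\<^sup>2)"

lemma power2_le_quarter:
  fixes a :: real
  assumes "0 \<le> a" "a \<le> 1/2"
  shows "a\<^sup>2 \<le> 1/4"
proof -
  have "a * a \<le> 1/2 * (1/2)" using assms by (intro mult_mono) auto
  then show ?thesis by (simp add: power2_eq_square)
qed

lemma pairing_le:
  fixes T X Y :: real
  assumes "0 \<le> T" "4 * (X\<^sup>2 + Y\<^sup>2) \<le> T\<^sup>2"
  shows "\<bar>Re r * X + Im r * Y\<bar> \<le> cmod r * T / 2"
proof -
  have "(Re r * X + Im r * Y)\<^sup>2 \<le> ((Re r)\<^sup>2 + (Im r)\<^sup>2) * (X\<^sup>2 + Y\<^sup>2)"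
    using zero_le_power2[of "Re r * Y - Im r * X"] by (simp add: power2_eq_square algebra_simps)
  also have "\<dots> \<le> (cmod r)\<^sup>2 * (T / 2)\<^sup>2"
    unfolding cmod_power2 using assms(2) by (intro mult_left_mono) (auto simp: power2_eq_square)
  also have "\<dots> = (cmod r * T / 2)\<^sup>2" by (simp add: power_mult_distrib power_divide)
  finally show ?thesis using assms(1) by (metis abs_le_square_iff abs_of_nonneg divide_nonneg_nonneg
        mult_nonneg_nonneg norm_ge_zero zero_le_numeral)
qed

lemma energy_bounds:
  fixes T X Y :: real
  assumes T: "0 \<le> T" "4 * (X\<^sup>2 + Y\<^sup>2) \<le> T\<^sup>2" and r: "cmod r \<le> 1/2"
  shows "T \<le> 3 * energy T X Y r" "energy T X Y r \<le> 3 * T"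
proof -
  define q where "q = cmod r"
  have q: "0 \<le> q" "q \<le> 1/2" using r by (auto simp: q_def)
  have pr: "\<bar>Re r * X + Im r * Y\<bar> \<le> q * T / 2" using pairing_le[OF T] by (simp add: q_def)
  have qq: "q\<^sup>2 \<le> 1/4" by (rule power2_le_quarter[OF q])
  then have w: "0 < 1 - q\<^sup>2" by simp
  have up: "(1 + q\<^sup>2) * T + 2 * q * T \<le> 3 * T * (1 - q\<^sup>2)"
  proof -
    have "0 \<le> T * (2 * (1 + q) * (1 - 2 * q))" using T(1) q by (intro mult_nonneg_nonneg) auto
    then show ?thesis by (simp add: algebra_simps power2_eq_square)
  qed
  have lo: "T * (1 - q\<^sup>2) \<le> 3 * ((1 + q\<^sup>2) * T - 2 * q * T)"
  proof -
    have "0 \<le> T * (2 * (1 - q) * (1 - 2 * q))" using T(1) q by (intro mult_nonneg_nonneg) auto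
    then show ?thesis by (simp add: algebra_simps power2_eq_square)
  qed
  have E: "energy T X Y r = ((1 + q\<^sup>2) * T - 4 * (Re r * X + Im r * Y)) / (1 - q\<^sup>2)"
    by (simp add: energy_def q_def)
  have "T * (1 - q\<^sup>2) \<le> 3 * ((1 + q\<^sup>2) * T - 4 * (Re r * X + Im r * Y))"
    using lo pr[unfolded abs_le_iff] by (simp add: algebra_simps)
  then show "T \<le> 3 * energy T X Y r" unfolding E using w by (simp add: pos_le_divide_eq)
  have "(1 + q\<^sup>2) * T - 4 * (Re r * X + Im r * Y) \<le> 3 * T * (1 - q\<^sup>2)"
    using up pr[unfolded abs_le_iff] by (simp add: algebra_simps)
  then show "energy T X Y r \<le> 3 * T" unfolding E using w by (simp add: pos_divide_le_eq)
qed

text \<open>On the disc of radius \<open>1/2\<close> the energy is Lipschitz in \<open>r\<close> with a constant proportional to \<open>T\<close>,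
  and \<open>T\<close> is in turn at most three times the energy; so a change of \<open>r\<close> multiplies the energy by a
  factor close to one.\<close>

lemma energy_jump:
  fixes T X Y :: real
  assumes T: "0 \<le> T" "4 * (X\<^sup>2 + Y\<^sup>2) \<le> T\<^sup>2" and r: "cmod r1 \<le> 1/2" "cmod r2 \<le> 1/2"
  shows "energy T X Y r2 \<le> (1 + 27 * cmod (r2 - r1)) * energy T X Y r1"
proof -
  define d where "d = cmod (r2 - r1)"
  define q1 where "q1 = (cmod r1)\<^sup>2"
  define q2 where "q2 = (cmod r2)\<^sup>2"
  define P1 where "P1 = Re r1 * X + Im r1 * Y"
  define P2 where "P2 = Re r2 * X + Im r2 * Y"
  have d0: "0 \<le> d" by (simp add: d_def)
  have q: "0 \<le> q1" "q1 \<le> 1/4" "0 \<le> q2" "q2 \<le> 1/4"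
    unfolding q1_def q2_def by (intro zero_le_power2 power2_le_quarter norm_ge_zero r)+
  have dq: "\<bar>q2 - q1\<bar> \<le> d"
  proof -
    have "q2 - q1 = (cmod r2 - cmod r1) * (cmod r2 + cmod r1)"
      by (simp add: q1_def q2_def power2_eq_square algebra_simps)
    then have "\<bar>q2 - q1\<bar> = \<bar>cmod r2 - cmod r1\<bar> * (cmod r2 + cmod r1)" by (simp add: abs_mult)
    also have "\<dots> \<le> d * 1"
      using r norm_triangle_ineq3[of r2 r1] d0 unfolding d_def by (intro mult_mono) auto
    finally show ?thesis by simp
  qed
  have dP: "\<bar>P2 - P1\<bar> \<le> d * T / 2"
    using pairing_le[OF T, of "r2 - r1"] by (simp add: P1_def P2_def d_def algebra_simps)
  have P1: "\<bar>P1\<bar> \<le> T / 4"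
  proof -
    have "cmod r1 * T \<le> 1/2 * T" using r(1) T(1) by (rule mult_right_mono)
    then show ?thesis using pairing_le[OF T, of r1] by (simp add: P1_def)
  qed
  define w1 where "w1 = 1 - q1"
  define w2 where "w2 = 1 - q2"
  have w: "3/4 \<le> w1" "3/4 \<le> w2" "w1 \<le> 1" using q by (auto simp: w1_def w2_def)
  have E1: "energy T X Y r1 * w1 = (1 + q1) * T - 4 * P1"
    using w by (simp add: energy_def q1_def[symmetric] P1_def[symmetric] w1_def)
  have E2: "energy T X Y r2 * w2 = (1 + q2) * T - 4 * P2"
    using w by (simp add: energy_def q2_def[symmetric] P2_def[symmetric] w2_def)
  have e1: "T \<le> 3 * energy T X Y r1" by (rule energy_bounds[OF T r(1)])
  have e1': "energy T X Y r1 \<le> 3 * T" by (rule energy_bounds[OF T r(1)])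
  have "energy T X Y r2 * w2 - energy T X Y r1 * w1 \<le> d * T + 2 * d * T"
  proof -
    have "(q2 - q1) * T \<le> d * T" using dq T(1) by (intro mult_right_mono) auto
    then show ?thesis unfolding E1 E2 using dP[unfolded abs_le_iff] by (simp add: algebra_simps)
  qed
  moreover have "energy T X Y r1 * (w1 - w2) \<le> 3 * T * d"
  proof -
    have "energy T X Y r1 * (w1 - w2) \<le> energy T X Y r1 * d"
      using dq e1 T(1) by (intro mult_left_mono) (auto simp: w1_def w2_def)
    also have "\<dots> \<le> 3 * T * d" using e1' d0 by (intro mult_right_mono) auto
    finally show ?thesis .
  qed
  ultimately have *: "(energy T X Y r2 - energy T X Y r1) * w2 \<le> 6 * (d * T)"
    by (simp add: algebra_simps)
  have "energy T X Y r2 - energy T X Y r1 \<le> 9 * (d * T)"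
  proof -
    have scale: "x \<le> 9 * y" if "x * w2 \<le> 6 * y" "0 \<le> y" for x y
    proof (cases "0 \<le> x")
      case True
      then have "x * (3/4) \<le> x * w2" using w by (intro mult_left_mono) auto
      then show ?thesis using that by linarith
    qed (use that in linarith)
    show ?thesis by (rule scale[OF *]) (use d0 T(1) in simp)
  qed
  also have "9 * (d * T) \<le> 27 * d * energy T X Y r1"
    using mult_left_mono[OF e1 d0] by (simp add: mult_ac)
  finally show ?thesis by (simp add: d_def algebra_simps)
qed


text \<open>Here \<open>eR + \<i> eI\<close> is the residual of \<open>r = R + \<i> I\<close> in the Riccati equation. By the quotient rule the
  left-hand side is the derivative of the energy times \<open>(1 - |r|\<^sup>2)\<^sup>2\<close>; all terms with \<open>W\<close> and
  \<open>\<eta>\<close> cancel, and only terms linear in the residual survive.\<close>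

lemma energy_derivative_identity:
  fixes T X Y R I W \<eta> eR eI :: real
  defines "T' \<equiv> 4 * W * Y"
    and "X' \<equiv> \<eta> * Y - 2 * W * Y"
    and "Y' \<equiv> - \<eta> * X + W * (T + 2 * X)"
    and "R' \<equiv> \<eta> * I - 2 * W * (1 + R) * I + eR"
    and "I' \<equiv> - \<eta> * R + W * ((1 + R)\<^sup>2 - I\<^sup>2) + eI"
    and "n \<equiv> (1 + (R\<^sup>2 + I\<^sup>2)) * T - 4 * (R * X + I * Y)"
  shows "(2 * (R * R' + I * I') * T + (1 + (R\<^sup>2 + I\<^sup>2)) * T' - 4 * (R' * X + R * X' + I' * Y + I * Y'))
      * (1 - (R\<^sup>2 + I\<^sup>2)) - n * (- (2 * (R * R' + I * I')))
    = (2 * (R * eR + I * eI) * T - 4 * (eR * X + eI * Y)) * (1 - (R\<^sup>2 + I\<^sup>2)) + 2 * n * (R * eR + I * eI)"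
  unfolding assms by (simp add: power2_eq_square) algebra


lemma energy_derivative_bound:
  fixes T X Y R I eR eI :: real
  assumes T: "0 \<le> T" "4 * (X\<^sup>2 + Y\<^sup>2) \<le> T\<^sup>2" and r: "cmod (Complex R I) \<le> 1/2"
  defines "n \<equiv> (1 + (R\<^sup>2 + I\<^sup>2)) * T - 4 * (R * X + I * Y)" and "w \<equiv> 1 - (R\<^sup>2 + I\<^sup>2)"
  shows "((2 * (R * eR + I * eI) * T - 4 * (eR * X + eI * Y)) * w + 2 * n * (R * eR + I * eI)) / w\<^sup>2
      \<le> 24 * cmod (Complex eR eI) * energy T X Y (Complex R I)"
proof -
  define \<epsilon> where "\<epsilon> = cmod (Complex eR eI)"
  define G where "G = energy T X Y (Complex R I)"
  have \<epsilon>: "0 \<le> \<epsilon>" by (simp add: \<epsilon>_def)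
  have q: "R\<^sup>2 + I\<^sup>2 \<le> 1/4"
  proof -
    have "(cmod (Complex R I))\<^sup>2 \<le> 1/4" by (rule power2_le_quarter[OF norm_ge_zero r])
    then show ?thesis unfolding cmod_power2 complex.sel .
  qed
  have w: "3/4 \<le> w" unfolding w_def using q by linarith
  have G: "T \<le> 3 * G" "G \<le> 3 * T" "0 \<le> G"
    using energy_bounds[OF T r] T(1) by (auto simp: G_def)
  have nG: "n = G * w"
  proof -
    have "G = n / w" unfolding G_def energy_def n_def w_def cmod_power2 complex.sel ..
    then show ?thesis using w by simp
  qed
  have inner: "\<bar>R * eR + I * eI\<bar> \<le> \<epsilon> / 2"
  proof -
    have "(R * eR + I * eI)\<^sup>2 \<le> (R\<^sup>2 + I\<^sup>2) * (eR\<^sup>2 + eI\<^sup>2)"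
      using zero_le_power2[of "R * eI - I * eR"] by (simp add: power2_eq_square algebra_simps)
    also have "eR\<^sup>2 + eI\<^sup>2 = \<epsilon>\<^sup>2" unfolding \<epsilon>_def cmod_power2 complex.sel ..
    also have "(R\<^sup>2 + I\<^sup>2) * \<epsilon>\<^sup>2 \<le> (1/4) * \<epsilon>\<^sup>2" by (rule mult_right_mono[OF q]) simp
    also have "\<dots> = (\<epsilon> / 2)\<^sup>2" by (simp add: power2_eq_square)
    finally show ?thesis using \<epsilon> by (metis abs_le_square_iff abs_of_nonneg divide_nonneg_nonneg zero_le_numeral)
  qed
  have pair: "\<bar>eR * X + eI * Y\<bar> \<le> \<epsilon> * T / 2"
    using pairing_le[OF T, of "Complex eR eI"] by (simp add: \<epsilon>_def)
  have "2 * (R * eR + I * eI) * T - 4 * (eR * X + eI * Y) \<le> 3 * (\<epsilon> * T)"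
  proof -
    have "2 * (R * eR + I * eI) * T \<le> \<epsilon> * T"
      using inner[unfolded abs_le_iff] T(1) by (intro mult_right_mono) auto
    then show ?thesis using pair[unfolded abs_le_iff] by simp
  qed
  also have "\<dots> \<le> 9 * (\<epsilon> * G)"
    using mult_left_mono[OF G(1) \<epsilon>] by (simp add: mult_ac)
  finally have 1: "(2 * (R * eR + I * eI) * T - 4 * (eR * X + eI * Y)) * w \<le> 9 * (\<epsilon> * G) * w"
    using w by (intro mult_right_mono) auto
  have "2 * n * (R * eR + I * eI) = (2 * (R * eR + I * eI)) * (G * w)" by (simp add: nG)
  also have "\<dots> \<le> \<epsilon> * (G * w)"
    using inner[unfolded abs_le_iff] G w by (intro mult_right_mono) auto
  finally have 2: "2 * n * (R * eR + I * eI) \<le> \<epsilon> * G * w" by simp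
  have "(2 * (R * eR + I * eI) * T - 4 * (eR * X + eI * Y)) * w + 2 * n * (R * eR + I * eI) \<le> 10 * (\<epsilon> * G) * w"
    using 1 2 by simp
  also have "\<dots> \<le> 24 * \<epsilon> * G * w\<^sup>2"
  proof -
    have "0 \<le> (\<epsilon> * G * w) * (24 * w - 10)" using \<epsilon> G w by (intro mult_nonneg_nonneg) auto
    then show ?thesis by (simp add: power2_eq_square algebra_simps)
  qed
  finally show ?thesis
    using w by (simp add: pos_divide_le_eq \<epsilon>_def G_def)
qed

text \<open>A Gronwall argument: the derivative of the energy is at most \<open>24 * g\<close> times the energy almost
  everywhere, so the energy times \<open>exp (- 24 * g * (x - s))\<close> is an absolutely continuous function whose
  derivative is nonpositive almost everywhere.\<close>

lemma energy_step:
  fixes T X Y W :: "real \<Rightarrow> real" and r r' :: "real \<Rightarrow> complex"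
  assumes st: "s \<le> t"
    and AC: "abs_continuous_on {s..t} T" "abs_continuous_on {s..t} X" "abs_continuous_on {s..t} Y"
    and ode: "AE x in lborel. x \<in> {s..t} \<longrightarrow>
        (T has_vector_derivative 4 * W x * Y x) (at x) \<and>
        (X has_vector_derivative \<eta> * Y x - 2 * W x * Y x) (at x) \<and>
        (Y has_vector_derivative - \<eta> * X x + W x * (T x + 2 * X x)) (at x)"
    and cone: "\<And>x. x \<in> {s..t} \<Longrightarrow> 0 \<le> T x" "\<And>x. x \<in> {s..t} \<Longrightarrow> 4 * ((X x)\<^sup>2 + (Y x)\<^sup>2) \<le> (T x)\<^sup>2"
    and r: "\<And>x. x \<in> {s..t} \<Longrightarrow> (r has_vector_derivative r' x) (at x)" "continuous_on {s..t} r'"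
    and small: "\<And>x. x \<in> {s..t} \<Longrightarrow> cmod (r x) \<le> 1/2"
    and res: "\<And>x. x \<in> {s..t} \<Longrightarrow>
        cmod (r' x - (- \<i> * of_real \<eta> * r x + \<i> * of_real (W x) * (1 + r x)\<^sup>2)) \<le> g"
  shows "energy (T t) (X t) (Y t) (r t) \<le> energy (T s) (X s) (Y s) (r s) * exp (24 * g * (t - s))"
proof -
  define R where "R x = Re (r x)" for x
  define I where "I x = Im (r x)" for x
  have ACr: "abs_continuous_on {s..t} r"
    by (rule abs_continuous_on_C1[OF _ r(2)]) (rule has_vector_derivative_at_within, rule r(1))
  have ACR: "abs_continuous_on {s..t} R" and ACI: "abs_continuous_on {s..t} I"
    using abs_continuous_on_bounded_linear[OF bounded_linear_Re ACr]
      abs_continuous_on_bounded_linear[OF bounded_linear_Im ACr]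
    unfolding R_def[abs_def] I_def[abs_def] by auto
  define n where "n x = (1 + ((R x)\<^sup>2 + (I x)\<^sup>2)) * T x - 4 * (R x * X x + I x * Y x)" for x
  define w where "w x = 1 - ((R x)\<^sup>2 + (I x)\<^sup>2)" for x
  define c where "c x = exp (- 24 * g * (x - s))" for x
  define F where "F x = n x * (1 / w x) * c x" for x
  have w: "3/4 \<le> w x" if "x \<in> {s..t}" for x
  proof -
    have "(cmod (r x))\<^sup>2 \<le> 1/4" by (rule power2_le_quarter[OF norm_ge_zero small[OF that]])
    then show ?thesis unfolding cmod_power2 w_def R_def I_def by linarith
  qed
  have En: "energy (T x) (X x) (Y x) (r x) = n x / w x" for x
    unfolding energy_def n_def w_def cmod_power2 R_def I_def ..
  have ACw: "abs_continuous_on {s..t} w"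
    unfolding w_def power2_eq_square
    by (intro abs_continuous_on_diff abs_continuous_on_const abs_continuous_on_add
        abs_continuous_on_mult_interval ACR ACI)
  have ACn: "abs_continuous_on {s..t} n"
    unfolding n_def power2_eq_square
    by (intro abs_continuous_on_diff abs_continuous_on_const abs_continuous_on_add abs_continuous_on_cmult
        abs_continuous_on_mult_interval ACR ACI AC)
  have c': "(c has_vector_derivative - 24 * g * c x) (at x)" for x
    unfolding c_def by (auto intro!: derivative_eq_intros simp flip: has_real_derivative_iff_has_vector_derivative)
  have ACc: "abs_continuous_on {s..t} c"
    by (rule abs_continuous_on_C1[OF has_vector_derivative_at_within[OF c']])
       (auto simp: c_def intro!: continuous_intros)
  have ACF: "abs_continuous_on {s..t} F"
    unfolding F_def
    by (intro abs_continuous_on_mult_interval ACn ACc abs_continuous_on_inverse[OF ACw, of "3/4"] w) auto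
  have "F t \<le> F s"
  proof (rule abs_continuous_on_antimono[OF ACF st], rule AE_mp[OF ode], rule AE_I2, intro impI)
    fix x assume x: "x \<in> {s..t}" and "x \<in> {s..t} \<longrightarrow>
        (T has_vector_derivative 4 * W x * Y x) (at x) \<and>
        (X has_vector_derivative \<eta> * Y x - 2 * W x * Y x) (at x) \<and>
        (Y has_vector_derivative - \<eta> * X x + W x * (T x + 2 * X x)) (at x)"
    then have D: "(T has_real_derivative 4 * W x * Y x) (at x)"
        "(X has_real_derivative \<eta> * Y x - 2 * W x * Y x) (at x)"
        "(Y has_real_derivative - \<eta> * X x + W x * (T x + 2 * X x)) (at x)"
      by (auto simp: has_real_derivative_iff_has_vector_derivative)
    define e where "e = r' x - (- \<i> * of_real \<eta> * r x + \<i> * of_real (W x) * (1 + r x)\<^sup>2)"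
    have e: "cmod e \<le> g" using res[OF x] by (simp add: e_def)
    have r'x: "r' x = - \<i> * of_real \<eta> * r x + \<i> * of_real (W x) * (1 + r x)\<^sup>2 + e"
      by (simp add: e_def)
    define R' where "R' = \<eta> * I x - 2 * W x * (1 + R x) * I x + Re e"
    define I' where "I' = - \<eta> * R x + W x * ((1 + R x)\<^sup>2 - (I x)\<^sup>2) + Im e"
    have "Re (r' x) = R'" "Im (r' x) = I'"
      unfolding r'x R'_def I'_def R_def I_def by (simp_all add: power2_eq_square algebra_simps)
    then have DR: "(R has_real_derivative R') (at x)" and DI: "(I has_real_derivative I') (at x)"
      using has_derivative_Re[OF r(1)[OF x, unfolded has_vector_derivative_def]]
        has_derivative_Im[OF r(1)[OF x, unfolded has_vector_derivative_def]]
      unfolding R_def I_def has_real_derivative_iff_has_vector_derivative has_vector_derivative_def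
      by (simp_all)
    define T' X' Y' where "T' = 4 * W x * Y x" and "X' = \<eta> * Y x - 2 * W x * Y x"
      and "Y' = - \<eta> * X x + W x * (T x + 2 * X x)"
    define n' where "n' = 2 * (R x * R' + I x * I') * T x + (1 + ((R x)\<^sup>2 + (I x)\<^sup>2)) * T'
        - 4 * (R' * X x + R x * X' + I' * Y x + I x * Y')"
    define w' where "w' = - (2 * (R x * R' + I x * I'))"
    note D' = D[folded T'_def X'_def Y'_def] DR DI
    have Dn: "(n has_real_derivative n') (at x)"
      unfolding n_def n'_def by (rule derivative_eq_intros D' refl | simp add: algebra_simps)+
    have Dw: "(w has_real_derivative w') (at x)"
      unfolding w_def w'_def by (rule derivative_eq_intros D' refl | simp add: algebra_simps)+
    have wx: "3/4 \<le> w x" "w x \<noteq> 0" using w[OF x] by auto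
    have DS: "((\<lambda>x. n x * (1 / w x)) has_real_derivative (n' * w x - n x * w') / (w x)\<^sup>2) (at x)"
      using wx(2) by (auto intro!: derivative_eq_intros Dn Dw simp: field_simps power2_eq_square)
    have rc: "Complex (R x) (I x) = r x" "Complex (Re e) (Im e) = e" by (simp_all add: R_def I_def)
    have "(n' * w x - n x * w') / (w x)\<^sup>2 \<le> 24 * cmod e * (n x / w x)"
      using energy_derivative_bound[OF cone(1)[OF x] cone(2)[OF x], of "R x" "I x" "Re e" "Im e"] small[OF x]
      unfolding n'_def w'_def n_def w_def T'_def X'_def Y'_def R'_def I'_def
        energy_derivative_identity rc En by simp
    also have "\<dots> \<le> 24 * g * (n x / w x)"
    proof (rule mult_right_mono)
      have "0 \<le> 3 * energy (T x) (X x) (Y x) (r x)"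
        using energy_bounds(1)[OF cone(1)[OF x] cone(2)[OF x] small[OF x]] cone(1)[OF x] by linarith
      then show "0 \<le> n x / w x" by (simp add: En)
    qed (use e in simp)
    finally have neg: "(n' * w x - n x * w') / (w x)\<^sup>2 - 24 * g * (n x / w x) \<le> 0" by simp
    have "(F has_real_derivative (n' * w x - n x * w') / (w x)\<^sup>2 * c x + n x * (1 / w x) * (- 24 * g * c x)) (at x)"
      unfolding F_def
      using DERIV_mult[OF DS c'[folded has_real_derivative_iff_has_vector_derivative]] by (simp add: mult_ac)
    moreover have "(n' * w x - n x * w') / (w x)\<^sup>2 * c x + n x * (1 / w x) * (- 24 * g * c x)
        = ((n' * w x - n x * w') / (w x)\<^sup>2 - 24 * g * (n x / w x)) * c x"
      by (simp add: left_diff_distrib)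
    moreover have "\<dots> \<le> 0" using neg by (intro mult_nonpos_nonneg) (auto simp: c_def)
    ultimately show "\<exists>D\<le>0. (F has_vector_derivative D) (at x within {s..t})"
      by (metis has_real_derivative_iff_has_vector_derivative has_vector_derivative_at_within)
  qed
  then have "n t / w t * c t \<le> n s / w s" by (simp add: F_def c_def)
  then have "n t / w t * c t * exp (24 * g * (t - s)) \<le> n s / w s * exp (24 * g * (t - s))"
    by (rule mult_right_mono) simp
  moreover have "c t * exp (24 * g * (t - s)) = 1"
    by (simp add: c_def flip: exp_add)
  ultimately show ?thesis unfolding En by (simp only: mult.assoc mult_1_right)
qed

text \<open>The amplitudes of a solution are \<open>(u - (2 * \<i> / \<eta>) * u') / 2\<close> and \<open>(u + (2 * \<i> / \<eta>) * u') / 2\<close>.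
  Their quadratic expressions \<open>T\<close>, \<open>X\<close>, \<open>Y\<close> are real and satisfy a linear system in which the potential
  enters as a coefficient; the inequality for \<open>X\<close> and \<open>Y\<close> is the Cauchy-Schwarz inequality.\<close>

lemma solution_bloch_vector:
  assumes sol: "is_solution V (\<eta>\<^sup>2 / 4) u" and \<eta>: "\<eta> > 0"
  obtains T X Y :: "real \<Rightarrow> real" where
    "\<And>s t. 0 < s \<Longrightarrow> abs_continuous_on {s..t} T"
    "\<And>s t. 0 < s \<Longrightarrow> abs_continuous_on {s..t} X"
    "\<And>s t. 0 < s \<Longrightarrow> abs_continuous_on {s..t} Y"
    "AE x in lborel. x > 0 \<longrightarrow>
        (T has_vector_derivative 4 * (V x / \<eta>) * Y x) (at x) \<and>
        (X has_vector_derivative \<eta> * Y x - 2 * (V x / \<eta>) * Y x) (at x) \<and>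
        (Y has_vector_derivative - \<eta> * X x + (V x / \<eta>) * (T x + 2 * X x)) (at x)"
    "\<And>x. 0 \<le> T x" "\<And>x. 4 * ((X x)\<^sup>2 + (Y x)\<^sup>2) \<le> (T x)\<^sup>2" "\<And>x. (cmod (u x))\<^sup>2 \<le> 2 * T x"
proof -
  obtain u' where u': "\<And>x. x > 0 \<Longrightarrow> (u has_vector_derivative u' x) (at x)"
    and acu: "loc_abs_continuous u" and acu': "loc_abs_continuous u'"
    and ode: "AE x in lborel. x > 0 \<longrightarrow> (\<exists>u''. (u' has_vector_derivative u'') (at x) \<and>
                     - u'' + of_real (V x) * u x = of_real (\<eta>\<^sup>2 / 4) * u x)"
    using sol unfolding is_solution_def by blast
  define a b a' b' where "a x = Re (u x)" and "b x = Im (u x)"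
    and "a' x = Re (u' x)" and "b' x = Im (u' x)" for x
  define k where "k = 4 / \<eta>\<^sup>2"
  define T where "T x = (a x * a x + b x * b x + k * (a' x * a' x + b' x * b' x)) * (1/2)" for x
  define X where "X x = (a x * a x + b x * b x - k * (a' x * a' x + b' x * b' x)) * (1/4)" for x
  define Y where "Y x = (a x * a' x + b x * b' x) * (1 / \<eta>)" for x
  have acI: "abs_continuous_on {s..t} f" if "loc_abs_continuous f" "0 < s" for f :: "real \<Rightarrow> complex" and s t
    by (rule abs_continuous_on_subset[of "{0<..max 1 t}"])
       (use that in \<open>auto simp: loc_abs_continuous_def\<close>)
  have ac: "abs_continuous_on {s..t} a" "abs_continuous_on {s..t} b"
    "abs_continuous_on {s..t} a'" "abs_continuous_on {s..t} b'" if "0 < s" for s t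
    using abs_continuous_on_bounded_linear[OF bounded_linear_Re acI[OF acu that]]
      abs_continuous_on_bounded_linear[OF bounded_linear_Im acI[OF acu that]]
      abs_continuous_on_bounded_linear[OF bounded_linear_Re acI[OF acu' that]]
      abs_continuous_on_bounded_linear[OF bounded_linear_Im acI[OF acu' that]]
    unfolding a_def[abs_def] b_def[abs_def] a'_def[abs_def] b'_def[abs_def] by auto
  show thesis
  proof (rule that[of T X Y])
    show "abs_continuous_on {s..t} T" "abs_continuous_on {s..t} X" "abs_continuous_on {s..t} Y"
      if "0 < s" for s t
      unfolding T_def X_def Y_def
      by (intro abs_continuous_on_mult_interval abs_continuous_on_const abs_continuous_on_add
          abs_continuous_on_diff ac that)+
    show "0 \<le> T x" for x by (simp add: T_def k_def)
    show "(cmod (u x))\<^sup>2 \<le> 2 * T x" for x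
      unfolding T_def k_def cmod_power2 a_def b_def by (simp add: power2_eq_square)
    show "4 * ((X x)\<^sup>2 + (Y x)\<^sup>2) \<le> (T x)\<^sup>2" for x
    proof -
      have "(T x)\<^sup>2 - 4 * (X x)\<^sup>2 = k * ((a x * a x + b x * b x) * (a' x * a' x + b' x * b' x))"
        by (simp add: T_def X_def power2_eq_square algebra_simps)
      moreover have "4 * (Y x)\<^sup>2 = k * (a x * a' x + b x * b' x)\<^sup>2"
        by (simp add: Y_def k_def power2_eq_square)
      moreover have "k * (a x * a' x + b x * b' x)\<^sup>2 \<le> k * ((a x * a x + b x * b x) * (a' x * a' x + b' x * b' x))"
      proof (rule mult_left_mono)
        show "(a x * a' x + b x * b' x)\<^sup>2 \<le> (a x * a x + b x * b x) * (a' x * a' x + b' x * b' x)"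
          using zero_le_power2[of "a x * b' x - b x * a' x"] by (simp add: power2_eq_square algebra_simps)
      qed (simp add: k_def)
      ultimately show ?thesis by (simp add: distrib_left)
    qed
    show "AE x in lborel. x > 0 \<longrightarrow>
        (T has_vector_derivative 4 * (V x / \<eta>) * Y x) (at x) \<and>
        (X has_vector_derivative \<eta> * Y x - 2 * (V x / \<eta>) * Y x) (at x) \<and>
        (Y has_vector_derivative - \<eta> * X x + (V x / \<eta>) * (T x + 2 * X x)) (at x)"
    proof (rule AE_mp[OF ode], rule AE_I2, intro impI)
      fix x :: real assume x: "x > 0" and "x > 0 \<longrightarrow> (\<exists>u''. (u' has_vector_derivative u'') (at x) \<and>
                     - u'' + of_real (V x) * u x = of_real (\<eta>\<^sup>2 / 4) * u x)"
      then obtain u'' where u'': "(u' has_vector_derivative u'') (at x)"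
        "- u'' + of_real (V x) * u x = of_real (\<eta>\<^sup>2 / 4) * u x" by blast
      define q where "q = V x - \<eta>\<^sup>2 / 4"
      have "of_real q * u x = of_real (V x) * u x - of_real (\<eta>\<^sup>2 / 4) * u x"
        unfolding q_def of_real_diff left_diff_distrib ..
      also have "\<dots> = u''" unfolding u''(2)[symmetric] by simp
      finally have q: "u'' = of_real q * u x" ..
      have ReD: "((\<lambda>t. Re (f t)) has_real_derivative Re D) (at x)"
        and ImD: "((\<lambda>t. Im (f t)) has_real_derivative Im D) (at x)"
        if "(f has_vector_derivative D) (at x)" for f D
        using has_derivative_Re[OF that[unfolded has_vector_derivative_def]]
          has_derivative_Im[OF that[unfolded has_vector_derivative_def]]
        unfolding has_real_derivative_iff_has_vector_derivative has_vector_derivative_def by simp_all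
      have D: "(a has_real_derivative a' x) (at x)" "(b has_real_derivative b' x) (at x)"
        "(a' has_real_derivative q * a x) (at x)" "(b' has_real_derivative q * b x) (at x)"
        using ReD[OF u'[OF x]] ImD[OF u'[OF x]] ReD[OF u''(1)] ImD[OF u''(1)]
        unfolding q a_def[abs_def] b_def[abs_def] a'_def[abs_def] b'_def[abs_def] by simp_all
      define A where "A = a x * a' x + b x * b' x"
      have DT: "(T has_real_derivative (2 * A + k * (2 * q * A)) * (1/2)) (at x)"
        unfolding T_def A_def by (rule derivative_eq_intros D refl | simp add: algebra_simps)+
      have DX: "(X has_real_derivative (2 * A - k * (2 * q * A)) * (1/4)) (at x)"
        unfolding X_def A_def by (rule derivative_eq_intros D refl | simp add: algebra_simps)+
      have DY: "(Y has_real_derivative (a' x * a' x + b' x * b' x + q * (a x * a x + b x * b x)) * (1 / \<eta>)) (at x)"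
        unfolding Y_def by (rule derivative_eq_intros D refl | simp add: algebra_simps)+
      have kq: "k * q = 4 * V x / \<eta>\<^sup>2 - 1" using \<eta> by (simp add: k_def q_def field_simps)
      have YA: "Y x = A / \<eta>" by (simp add: Y_def A_def)
      have "(2 * A + k * (2 * q * A)) * (1/2) = A + (k * q) * A" by (simp add: algebra_simps)
      also have "\<dots> = 4 * (V x / \<eta>) * Y x" unfolding kq YA using \<eta> by (simp add: field_simps power2_eq_square)
      finally have 1: "(2 * A + k * (2 * q * A)) * (1/2) = 4 * (V x / \<eta>) * Y x" .
      have "(2 * A - k * (2 * q * A)) * (1/4) = (A - (k * q) * A) / 2" by (simp add: algebra_simps)
      also have "\<dots> = \<eta> * Y x - 2 * (V x / \<eta>) * Y x"
        unfolding kq YA using \<eta> by (simp add: field_simps power2_eq_square)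
      finally have 2: "(2 * A - k * (2 * q * A)) * (1/4) = \<eta> * Y x - 2 * (V x / \<eta>) * Y x" .
      have TX: "T x + 2 * X x = a x * a x + b x * b x" by (simp add: T_def X_def algebra_simps)
      define P Q where "P = a x * a x + b x * b x" and "Q = a' x * a' x + b' x * b' x"
      have EX: "\<eta> * X x = \<eta> / 4 * P - Q / \<eta>"
        using \<eta> by (simp add: X_def k_def P_def[symmetric] Q_def[symmetric] field_simps power2_eq_square)
      have qe: "q / \<eta> = V x / \<eta> - \<eta> / 4" using \<eta> by (simp add: q_def field_simps power2_eq_square)
      have "(Q + q * P) * (1 / \<eta>) = Q / \<eta> + (q / \<eta>) * P" by (simp add: add_divide_distrib)
      also have "\<dots> = - (\<eta> * X x) + (V x / \<eta>) * P" unfolding qe EX by (simp add: left_diff_distrib)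
      finally have 3: "(a' x * a' x + b' x * b' x + q * (a x * a x + b x * b x)) * (1 / \<eta>)
          = - \<eta> * X x + (V x / \<eta>) * (T x + 2 * X x)"
        unfolding TX P_def Q_def by simp
      show "(T has_vector_derivative 4 * (V x / \<eta>) * Y x) (at x) \<and>
        (X has_vector_derivative \<eta> * Y x - 2 * (V x / \<eta>) * Y x) (at x) \<and>
        (Y has_vector_derivative - \<eta> * X x + (V x / \<eta>) * (T x + 2 * X x)) (at x)"
        using DT DX DY unfolding 1 2 3 has_real_derivative_iff_has_vector_derivative by blast
    qed
  qed
qed

section \<open>Frozen coefficients: bounds uniform in the cutoff\<close>

text \<open>Dominated convergence for sums, in a form that is uniform in the set of summation: the
  frequencies are cut off at a number \<open>N\<close> that is chosen only after \<open>n\<close>.\<close>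

lemma uniform_tannery:
  fixes B :: "'i \<Rightarrow> real" and F :: "nat \<Rightarrow> 'i \<Rightarrow> real"
  assumes B: "B summable_on I" "\<And>i. i \<in> I \<Longrightarrow> 0 \<le> B i"
    and F: "\<And>i. i \<in> I \<Longrightarrow> (\<lambda>n. F n i) \<longlonglongrightarrow> 0" "\<And>n i. i \<in> I \<Longrightarrow> 0 \<le> F n i"
      "\<And>n i. i \<in> I \<Longrightarrow> F n i \<le> C"
    and e: "e > 0"
  shows "\<forall>\<^sub>F n in sequentially. \<forall>S. finite S \<and> S \<subseteq> I \<longrightarrow> (\<Sum>i\<in>S. B i * F n i) \<le> e"
proof -
  define D where "D = \<bar>C\<bar> + 1"
  have D: "D > 0" "C \<le> D" by (auto simp: D_def)
  obtain G where G: "finite G" "G \<subseteq> I" "dist (sum B G) (infsum B I) \<le> e / (2 * D)"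
    using infsum_finite_approximation[OF B(1), of "e / (2 * D)"] e D by auto
  have "(\<lambda>n. \<Sum>i\<in>G. B i * F n i) \<longlonglongrightarrow> (\<Sum>i\<in>G. B i * 0)"
    using G(2) by (intro tendsto_sum tendsto_mult_left F(1)) auto
  then have "\<forall>\<^sub>F n in sequentially. (\<Sum>i\<in>G. B i * F n i) < e / 2"
    using e by (intro order_tendstoD(2)) auto
  then show ?thesis
  proof eventually_elim
    case (elim n)
    show ?case
    proof (intro allI impI)
      fix S assume S: "finite S \<and> S \<subseteq> I"
      have "(\<Sum>i\<in>S. B i * F n i) \<le> (\<Sum>i\<in>G \<union> (S - G). B i * F n i)"
        using S G B(2) F(2) by (intro sum_mono2) auto
      also have "\<dots> = (\<Sum>i\<in>G. B i * F n i) + (\<Sum>i\<in>S - G. B i * F n i)"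
        using S G by (intro sum.union_disjoint) auto
      also have "(\<Sum>i\<in>S - G. B i * F n i) \<le> (\<Sum>i\<in>S - G. B i * D)"
        using S B(2) order_trans[OF F(3) D(2)] by (intro sum_mono mult_left_mono) auto
      also have "\<dots> = (sum B (G \<union> (S - G)) - sum B G) * D"
        using S G by (subst sum.union_disjoint) (auto simp: sum_distrib_right)
      also have "\<dots> \<le> (infsum B I - sum B G) * D"
        using S G B D by (intro mult_right_mono diff_right_mono finite_sum_le_infsum) auto
      also have "\<dots> \<le> e / (2 * D) * D"
        using G(3) D by (intro mult_right_mono) (auto simp: dist_real_def)
      also have "\<dots> = e / 2" using D by simp
      finally show "(\<Sum>i\<in>S. B i * F n i) \<le> e" using elim by simp
    qed
  qed
qed

lemma prod_list_bounds:
  fixes f :: "'a \<Rightarrow> real"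
  assumes "\<And>k. k \<in> set ks \<Longrightarrow> 0 \<le> f k \<and> f k \<le> M"
  shows "0 \<le> prod_list (map f ks) \<and> prod_list (map f ks) \<le> M ^ length ks"
  using assms
proof (induction ks)
  case (Cons k ks)
  then have "0 \<le> f k" "f k \<le> M" "0 \<le> prod_list (map f ks)" "prod_list (map f ks) \<le> M ^ length ks" by auto
  then show ?case by (auto intro!: mult_mono)
qed simp

lemma norm_prod_list_diff_le:
  fixes f g :: "'a \<Rightarrow> complex"
  assumes "\<And>k. k \<in> set ks \<Longrightarrow> cmod (f k) \<le> M \<and> cmod (g k) \<le> M" and M: "1 \<le> M"
  shows "cmod (prod_list (map f ks) - prod_list (map g ks))
    \<le> M ^ length ks * sum_list (map (\<lambda>k. cmod (f k - g k)) ks)"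
  using assms(1)
proof (induction ks)
  case (Cons k ks)
  define Pf Pg s where "Pf = prod_list (map f ks)" and "Pg = prod_list (map g ks)"
    and "s = sum_list (map (\<lambda>k. cmod (f k - g k)) ks)"
  have IH: "cmod (Pf - Pg) \<le> M ^ length ks * s" using Cons by (simp add: Pf_def Pg_def s_def)
  have g: "cmod (g k) \<le> M" using Cons.prems by simp
  have cf: "cmod (prod_list (map f l)) = prod_list (map (\<lambda>k. cmod (f k)) l)" for l
    by (induction l) (auto simp: norm_mult)
  have Pf: "cmod Pf \<le> M ^ length ks"
    using prod_list_bounds[of ks "\<lambda>k. cmod (f k)" M] Cons.prems by (simp add: Pf_def cf)
  have Ms: "M ^ length ks \<le> M ^ Suc (length ks)" using M by (intro power_increasing) auto
  have "f k * Pf - g k * Pg = (f k - g k) * Pf + g k * (Pf - Pg)" by (simp add: algebra_simps)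
  also have "cmod \<dots> \<le> cmod (f k - g k) * cmod Pf + cmod (g k) * cmod (Pf - Pg)"
    by (rule order_trans[OF norm_triangle_ineq]) (simp add: norm_mult)
  also have "\<dots> \<le> cmod (f k - g k) * M ^ Suc (length ks) + M * (M ^ length ks * s)"
    using order_trans[OF Pf Ms] g IH M by (intro add_mono mult_mono mult_left_mono) auto
  also have "\<dots> = M ^ length (k # ks) * (cmod (f k - g k) + s)" by (simp add: algebra_simps)
  finally show ?case by (simp add: Pf_def Pg_def s_def)
qed simp

text \<open>A product of at least \<open>p\<close> numbers in \<open>[0, M]\<close> is, up to the powers of \<open>M\<close>, at most
  the \<open>p\<close>-th power of its largest factor.\<close>

lemma prod_list_le_sum_powers:
  fixes f :: "'a \<Rightarrow> real"
  assumes f: "\<And>k. k \<in> set ks \<Longrightarrow> 0 \<le> f k \<and> f k \<le> M" and M: "1 \<le> M"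
    and p: "1 \<le> p" "p \<le> length ks"
  shows "prod_list (map f ks) \<le> M ^ length ks * sum_list (map (\<lambda>k. f k ^ p) ks)"
proof -
  have ne: "set ks \<noteq> {}" using p by auto
  define y where "y = Max (f ` set ks)"
  have "y \<in> f ` set ks" unfolding y_def using ne by (intro Max_in) auto
  then obtain k where k: "k \<in> set ks" "f k = y" by auto
  have y: "0 \<le> y" "y \<le> M" using f k by auto
  have "f i \<le> y" if "i \<in> set ks" for i using that by (auto simp: y_def)
  then have "prod_list (map f ks) \<le> y ^ length ks"
    using prod_list_bounds[of ks f y] f by auto
  also have "\<dots> = y ^ (length ks - p) * y ^ p" using p by (simp flip: power_add)
  also have "\<dots> \<le> M ^ length ks * y ^ p"
  proof (intro mult_right_mono)
    have "y ^ (length ks - p) \<le> M ^ (length ks - p)" using y by (intro power_mono) auto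
    also have "\<dots> \<le> M ^ length ks" using M by (intro power_increasing) auto
    finally show "y ^ (length ks - p) \<le> M ^ length ks" .
  qed (use y in auto)
  also have "y ^ p \<le> sum_list (map (\<lambda>k. f k ^ p) ks)"
  proof (rule member_le_sum_list)
    show "y ^ p \<in> set (map (\<lambda>k. f k ^ p) ks)" using k by auto
    show "0 \<le> x" if "x \<in> set (map (\<lambda>k. f k ^ p) ks)" for x
      using that f by auto
  qed
  finally show ?thesis using M by simp
qed

lemma prod_list_map_mult:
  "prod_list (map (\<lambda>k. f k * g k) ks) = prod_list (map f ks) * prod_list (map g ks :: 'b::comm_monoid_mult list)"
  by (induction ks) (simp_all add: mult_ac)

lemma norm_prod_list_map:
  "cmod (prod_list (map f ks)) = prod_list (map (\<lambda>k. cmod (f k)) ks)"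
  by (induction ks) (simp_all add: norm_mult)

lemma sum_triple_product:
  fixes f :: "'a \<Rightarrow> real" and g :: "'b \<Rightarrow> real" and r :: "'c \<Rightarrow> real"
  shows "sum f A * (sum g word_coeff * sum r C) = (\<Sum>(k, b, c)\<in>A \<times> word_coeff \<times> C. f k * (g b * r c))"
proof -
  have "sum g word_coeff * sum r C = (\<Sum>w\<in>word_coeff \<times> C. g (fst w) * r (snd w))"
    by (simp add: sum_product sum.cartesian_product case_prod_beta)
  then have "sum f A * (sum g word_coeff * sum r C) = (\<Sum>w\<in>A \<times> word_coeff \<times> C. f (fst w) * (g (fst (snd w)) * r (snd (snd w))))"
    by (simp add: sum_product sum.cartesian_product case_prod_beta)
  then show ?thesis by (simp add: case_prod_beta)
qed

lemma norm_exp_phase: "cmod (exp (- \<i> * of_real s * of_real x)) = 1"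
  by (simp add: norm_exp_eq_Re)

lemma continuous_on_wave: "continuous_on S (wave \<phi> z N)"
  unfolding wave_def by (intro continuous_intros)

lemma continuous_on_h_wave: "continuous_on S (h_wave \<eta> \<phi> z N J)"
  unfolding h_wave_def by (intro continuous_intros)

lemma continuous_on_reflection: "continuous_on S (reflection \<eta> \<phi> z N p)"
  unfolding reflection_def by (intro continuous_intros continuous_on_h_wave)

lemma continuous_on_reflection_error: "continuous_on S (reflection_error \<eta> \<phi> z N p)"
  unfolding reflection_error_def case_prod_beta
  by (intro continuous_intros continuous_on_h_wave continuous_on_wave)

text \<open>The hypotheses of the theorem in discrete form. The coefficients \<open>a\<close> are those of \<open>V / \<eta>\<close>, and
  \<open>v k n\<close> bounds the oscillation of \<open>\<gamma> k\<close> on the interval from \<open>n\<close> to \<open>n + 1\<close>. The sums over \<open>n\<close>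
  are bounded separately for each \<open>k\<close>, with bounds uniform in \<open>k\<close>; the sums over words,
  which converge absolutely, are taken last.\<close>

locale frozen_potential =
  fixes a :: "nat \<Rightarrow> complex" and \<phi> :: "nat \<Rightarrow> real" and \<gamma> :: "nat \<Rightarrow> real \<Rightarrow> complex"
    and \<eta> M K :: real and p :: nat and v :: "nat \<Rightarrow> nat \<Rightarrow> real"
  assumes p: "2 \<le> p" and M: "1 \<le> M"
    and \<gamma>_le: "\<And>k x. 0 < x \<Longrightarrow> cmod (\<gamma> k x) \<le> M"
    and osc: "\<And>k n x. 1 \<le> n \<Longrightarrow> real n \<le> x \<Longrightarrow> x \<le> real n + 1 \<Longrightarrow> cmod (\<gamma> k x - \<gamma> k (real n)) \<le> v k n"
    and osc_sum: "\<And>k m. (\<Sum>n=1..m. v k n) \<le> 2 * M"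
    and pow_sum: "\<And>k m. (\<Sum>n=1..m. cmod (\<gamma> k (real n)) ^ p) \<le> K"
    and a_summable: "summable (\<lambda>k. cmod (a k))"
    and denominators: "\<And>ks. length ks \<in> {1..p-1} \<Longrightarrow> \<eta> - sum_list (map \<phi> ks) \<noteq> 0"
    and h_summable: "\<And>J. J \<in> {1..p-1} \<Longrightarrow>
      (\<lambda>ks. cmod (prod_list (map a ks)) * \<bar>h \<eta> (map \<phi> ks)\<bar>) summable_on {ks. length ks = J}"
begin

definition word_coeff :: "nat list \<Rightarrow> real" where
  "word_coeff ks = cmod (prod_list (map a ks)) * \<bar>h \<eta> (map \<phi> ks)\<bar>"

definition word_total :: "nat \<Rightarrow> real" where
  "word_total J = infsum word_coeff {ks. length ks = J}"

definition a_total :: real where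
  "a_total = (\<Sum>k. cmod (a k))"

definition a_tail :: "nat \<Rightarrow> real" where
  "a_tail N = (\<Sum>k. cmod (a (k + N)))"

definition frozen :: "nat \<Rightarrow> nat \<Rightarrow> complex" where
  "frozen n k = a k * \<gamma> k (real n)"

definition \<gamma>_prod :: "nat \<Rightarrow> nat list \<Rightarrow> real" where
  "\<gamma>_prod n ks = prod_list (map (\<lambda>k. cmod (\<gamma> k (real n))) ks)"

lemma word_coeff_nonneg: "0 \<le> word_coeff ks"
  by (simp add: word_coeff_def)

lemma word_coeff_summable: "J < p \<Longrightarrow> word_coeff summable_on {ks. length ks = J}"
  using h_summable[of J] unfolding word_coeff_def by (cases "J = 0") auto

lemma sum_word_coeff_le: "J < p \<Longrightarrow> (\<Sum>ks\<in>words N J. word_coeff ks) \<le> word_total J"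
  unfolding word_total_def
  by (rule finite_sum_le_infsum[OF word_coeff_summable finite_words]) (auto simp: word_coeff_nonneg words_def)

lemma word_total_nonneg: "0 \<le> word_total J"
  unfolding word_total_def by (rule infsum_nonneg) (rule word_coeff_nonneg)

lemma sum_a_le: "(\<Sum>k<N. cmod (a k)) \<le> a_total"
  unfolding a_total_def by (rule sum_le_suminf[OF a_summable]) auto

lemma a_total_nonneg: "0 \<le> a_total"
  using sum_a_le[of 0] by simp

lemma v_nonneg: "1 \<le> n \<Longrightarrow> 0 \<le> v k n"
  using osc[of n "real n" k] by simp

lemma \<gamma>_prod_bounds: "1 \<le> n \<Longrightarrow> 0 \<le> \<gamma>_prod n ks \<and> \<gamma>_prod n ks \<le> M ^ length ks"
  unfolding \<gamma>_prod_def by (rule prod_list_bounds) (simp add: \<gamma>_le)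

lemma cmod_h_wave_le:
  "cmod (h_wave \<eta> \<phi> (frozen n) N J x) \<le> (\<Sum>ks\<in>words N J. word_coeff ks * \<gamma>_prod n ks)"
  unfolding h_wave_def
proof (rule sum_norm_le)
  fix ks
  show "cmod (prod_list (map (frozen n) ks) * of_real (h \<eta> (map \<phi> ks)) *
      exp (- \<i> * of_real (sum_list (map \<phi> ks)) * of_real x)) \<le> word_coeff ks * \<gamma>_prod n ks"
    unfolding norm_mult norm_exp_phase frozen_def prod_list_map_mult word_coeff_def \<gamma>_prod_def norm_prod_list_map[of "\<lambda>k. \<gamma> k (real n)"]
    by simp
qed

lemma cmod_wave_le: "cmod (wave \<phi> (frozen n) N x) \<le> (\<Sum>k<N. cmod (a k) * cmod (\<gamma> k (real n)))"
  unfolding wave_def by (rule sum_norm_le) (unfold norm_mult norm_exp_phase frozen_def, simp)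

definition pairs :: "(nat \<times> nat) set" where
  "pairs = {(j,l). j < p \<and> l < p \<and> p - 1 \<le> j + l}"

text \<open>Freezing the \<open>\<gamma> k\<close> at \<open>n\<close> makes every bound on the interval from \<open>n\<close> to \<open>n + 1\<close> a number that depends
  on \<open>n\<close> and on the cutoff \<open>N\<close> only. What matters is that the sum of these numbers over \<open>n\<close> is bounded
  independently of \<open>N\<close>.\<close>

definition err_bound :: "nat \<Rightarrow> nat \<Rightarrow> real" where
  "err_bound N n = (\<Sum>(j,l)\<in>pairs. (\<Sum>k<N. cmod (a k) * cmod (\<gamma> k (real n))) *
     ((\<Sum>ks\<in>words N j. word_coeff ks * \<gamma>_prod n ks) * (\<Sum>ks\<in>words N l. word_coeff ks * \<gamma>_prod n ks)))"

lemma cmod_reflection_error_le: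
  assumes n: "1 \<le> n"
  shows "cmod (reflection_error \<eta> \<phi> (frozen n) N p x) \<le> err_bound N n"
  unfolding reflection_error_def pairs_def[symmetric] sum_distrib_left
  unfolding err_bound_def case_prod_beta
proof (rule sum_norm_le)
  fix w :: "nat \<times> nat"
  have nn: "0 \<le> (\<Sum>ks\<in>words N i. word_coeff ks * \<gamma>_prod n ks)" for i
    using \<gamma>_prod_bounds[OF n] word_coeff_nonneg by (intro sum_nonneg mult_nonneg_nonneg) auto
  show "cmod (wave \<phi> (frozen n) N x * (h_wave \<eta> \<phi> (frozen n) N (fst w) x * h_wave \<eta> \<phi> (frozen n) N (snd w) x))
     \<le> (\<Sum>k<N. cmod (a k) * cmod (\<gamma> k (real n))) *
       ((\<Sum>ks\<in>words N (fst w). word_coeff ks * \<gamma>_prod n ks) * (\<Sum>ks\<in>words N (snd w). word_coeff ks * \<gamma>_prod n ks))"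
    unfolding norm_mult
    by (intro mult_mono cmod_wave_le cmod_h_wave_le mult_nonneg_nonneg nn norm_ge_zero sum_nonneg)
qed

definition pow_total :: real where "pow_total = M ^ (2 * p) * (real (2 * p) * K)"

lemma K_nonneg: "0 \<le> K"
  using pow_sum[of 0 0] by simp

lemma sum_list_swap:
  "(\<Sum>n\<in>S. sum_list (map (\<lambda>k. f k n) ks)) = sum_list (map (\<lambda>k. \<Sum>n\<in>S. f k n) ks)"
  for f :: "'k \<Rightarrow> 'n \<Rightarrow> real"
  by (induction ks) (simp_all add: sum.distrib)

lemma sum_list_le_length:
  "(\<And>k. f k \<le> (c::real)) \<Longrightarrow> sum_list (map f ks) \<le> real (length ks) * c"
  by (induction ks) (auto simp: algebra_simps intro: add_mono)

lemma sum_\<gamma>_prod_le: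
  assumes "p \<le> length ms" "length ms \<le> 2 * p"
  shows "(\<Sum>n=1..m. \<gamma>_prod n ms) \<le> pow_total"
proof -
  have "(\<Sum>n=1..m. \<gamma>_prod n ms)
      \<le> (\<Sum>n=1..m. M ^ length ms * sum_list (map (\<lambda>k. cmod (\<gamma> k (real n)) ^ p) ms))"
    unfolding \<gamma>_prod_def using assms p M by (intro sum_mono prod_list_le_sum_powers) (auto simp: \<gamma>_le)
  also have "\<dots> = M ^ length ms * sum_list (map (\<lambda>k. \<Sum>n=1..m. cmod (\<gamma> k (real n)) ^ p) ms)"
    by (simp add: sum_distrib_left[symmetric] sum_list_swap)
  also have "\<dots> \<le> M ^ (2 * p) * (real (2 * p) * K)"
  proof (intro mult_mono power_increasing M assms(2))
    have "sum_list (map (\<lambda>k. \<Sum>n=1..m. cmod (\<gamma> k (real n)) ^ p) ms) \<le> real (length ms) * K"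
      by (rule sum_list_le_length) (rule pow_sum)
    also have "\<dots> \<le> real (2 * p) * K" using assms(2) K_nonneg by (intro mult_right_mono) auto
    finally show "sum_list (map (\<lambda>k. \<Sum>n=1..m. cmod (\<gamma> k (real n)) ^ p) ms) \<le> real (2 * p) * K" .
  qed (use M in \<open>auto intro!: sum_list_nonneg sum_nonneg\<close>)
  finally show ?thesis by (simp add: pow_total_def)
qed

definition err_total :: real where
  "err_total = (\<Sum>(j,l)\<in>pairs. a_total * (word_total j * word_total l) * pow_total)"

lemma pow_total_nonneg: "0 \<le> pow_total"
  using M K_nonneg by (simp add: pow_total_def)

text \<open>The error contains products of at least \<open>p\<close> of the numbers \<open>\<gamma> k n\<close>, and for each choice of
  the indices \<open>k\<close> the sum over \<open>n\<close> of such a product is bounded by the \<open>p\<close>-th power sums.\<close>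

lemma sum_err_le: "(\<Sum>n=1..m. err_bound N n) \<le> err_total"
proof -
  have "(\<Sum>n=1..m. err_bound N n) = (\<Sum>(j,l)\<in>pairs. \<Sum>n=1..m. (\<Sum>k<N. cmod (a k) * cmod (\<gamma> k (real n))) *
     ((\<Sum>ks\<in>words N j. word_coeff ks * \<gamma>_prod n ks) * (\<Sum>ks\<in>words N l. word_coeff ks * \<gamma>_prod n ks)))"
    unfolding err_bound_def case_prod_beta by (rule sum.swap)
  also have "\<dots> \<le> err_total"
    unfolding err_total_def
  proof (rule sum_mono, clarify)
    fix j l assume "(j, l) \<in> pairs"
    then have jl: "j < p" "l < p" "p - 1 \<le> j + l" by (auto simp: pairs_def)
    let ?P = "{..<N} \<times> words N j \<times> words N l"
    have "(\<Sum>n=1..m. (\<Sum>k<N. cmod (a k) * cmod (\<gamma> k (real n))) *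
        ((\<Sum>ks\<in>words N j. word_coeff ks * \<gamma>_prod n ks) * (\<Sum>ks\<in>words N l. word_coeff ks * \<gamma>_prod n ks)))
      = (\<Sum>n=1..m. \<Sum>(k,ks,ls)\<in>?P. (cmod (a k) * (word_coeff ks * word_coeff ls)) * \<gamma>_prod n (k # ks @ ls))"
      unfolding sum_triple_product by (intro sum.cong refl) (auto simp: \<gamma>_prod_def)
    also have "\<dots> = (\<Sum>(k,ks,ls)\<in>?P. (cmod (a k) * (word_coeff ks * word_coeff ls)) * (\<Sum>n=1..m. \<gamma>_prod n (k # ks @ ls)))"
      unfolding sum_distrib_left case_prod_beta by (rule sum.swap)
    also have "\<dots> \<le> (\<Sum>(k,ks,ls)\<in>?P. (cmod (a k) * (word_coeff ks * word_coeff ls)) * pow_total)"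
    proof (rule sum_mono, clarify)
      fix k ks ls assume "ks \<in> words N j" "ls \<in> words N l"
      then show "cmod (a k) * (word_coeff ks * word_coeff ls) * (\<Sum>n=1..m. \<gamma>_prod n (k # ks @ ls)) \<le> cmod (a k) * (word_coeff ks * word_coeff ls) * pow_total"
        using jl by (intro mult_left_mono sum_\<gamma>_prod_le mult_nonneg_nonneg word_coeff_nonneg) (auto simp: words_def)
    qed
    also have "\<dots> = (\<Sum>k<N. cmod (a k)) * (sum word_coeff (words N j) * sum word_coeff (words N l)) * pow_total"
      unfolding sum_triple_product by (simp add: sum_distrib_right case_prod_beta)
    also have "\<dots> \<le> a_total * (word_total j * word_total l) * pow_total"
      using jl by (intro mult_right_mono mult_mono sum_a_le sum_word_coeff_le mult_nonneg_nonneg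
          pow_total_nonneg word_total_nonneg a_total_nonneg sum_nonneg word_coeff_nonneg norm_ge_zero)
    finally show "(\<Sum>n=1..m. (\<Sum>k<N. cmod (a k) * cmod (\<gamma> k (real n))) *
        ((\<Sum>ks\<in>words N j. word_coeff ks * \<gamma>_prod n ks) * (\<Sum>ks\<in>words N l. word_coeff ks * \<gamma>_prod n ks)))
      \<le> a_total * (word_total j * word_total l) * pow_total" .
  qed
  finally show ?thesis .
qed

definition jump_bound :: "nat \<Rightarrow> nat \<Rightarrow> real" where
  "jump_bound N n = (\<Sum>J=1..p-1. \<Sum>ks\<in>words N J. word_coeff ks * (M ^ J * sum_list (map (\<lambda>k. v k n) ks)))"

lemma cmod_reflection_jump_le:
  assumes n: "1 \<le> n"
  shows "cmod (reflection \<eta> \<phi> (frozen (Suc n)) N p x - reflection \<eta> \<phi> (frozen n) N p x) \<le> jump_bound N n"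
proof -
  have "reflection \<eta> \<phi> (frozen (Suc n)) N p x - reflection \<eta> \<phi> (frozen n) N p x
      = (\<Sum>J=1..p-1. h_wave \<eta> \<phi> (frozen (Suc n)) N J x - h_wave \<eta> \<phi> (frozen n) N J x)"
    by (simp add: reflection_def sum_subtractf)
  also have "cmod \<dots> \<le> jump_bound N n"
    unfolding jump_bound_def
  proof (rule sum_norm_le)
    fix J
    have "h_wave \<eta> \<phi> (frozen (Suc n)) N J x - h_wave \<eta> \<phi> (frozen n) N J x =
        (\<Sum>ks\<in>words N J. (prod_list (map (frozen (Suc n)) ks) - prod_list (map (frozen n) ks)) * of_real (h \<eta> (map \<phi> ks)) *
          exp (- \<i> * of_real (sum_list (map \<phi> ks)) * of_real x))"
      unfolding h_wave_def by (simp add: sum_subtractf left_diff_distrib)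
    also have "cmod \<dots> \<le> (\<Sum>ks\<in>words N J. word_coeff ks * (M ^ J * sum_list (map (\<lambda>k. v k n) ks)))"
    proof (rule sum_norm_le)
      fix ks assume ks: "ks \<in> words N J"
      have "cmod (prod_list (map (\<lambda>k. \<gamma> k (real (Suc n))) ks) - prod_list (map (\<lambda>k. \<gamma> k (real n)) ks))
          \<le> M ^ length ks * sum_list (map (\<lambda>k. cmod (\<gamma> k (real (Suc n)) - \<gamma> k (real n))) ks)"
        using n by (intro norm_prod_list_diff_le M conjI \<gamma>_le) auto
      also have "\<dots> \<le> M ^ length ks * sum_list (map (\<lambda>k. v k n) ks)"
        using n M by (intro mult_left_mono sum_list_mono osc) auto
      finally have d: "cmod (prod_list (map (\<lambda>k. \<gamma> k (real (Suc n))) ks) - prod_list (map (\<lambda>k. \<gamma> k (real n)) ks))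
          \<le> M ^ J * sum_list (map (\<lambda>k. v k n) ks)" using ks by (simp add: words_def)
      have "prod_list (map (frozen (Suc n)) ks) - prod_list (map (frozen n) ks) = prod_list (map a ks) *
          (prod_list (map (\<lambda>k. \<gamma> k (real (Suc n))) ks) - prod_list (map (\<lambda>k. \<gamma> k (real n)) ks))"
        unfolding frozen_def prod_list_map_mult by (simp add: right_diff_distrib)
      then show "cmod ((prod_list (map (frozen (Suc n)) ks) - prod_list (map (frozen n) ks)) * of_real (h \<eta> (map \<phi> ks)) *
          exp (- \<i> * of_real (sum_list (map \<phi> ks)) * of_real x)) \<le> word_coeff ks * (M ^ J * sum_list (map (\<lambda>k. v k n) ks))"
        using mult_left_mono[OF d word_coeff_nonneg[of ks]]
        unfolding norm_mult norm_exp_phase by (simp add: norm_mult word_coeff_def mult_ac)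
    qed
    finally show "cmod (h_wave \<eta> \<phi> (frozen (Suc n)) N J x - h_wave \<eta> \<phi> (frozen n) N J x)
        \<le> (\<Sum>ks\<in>words N J. word_coeff ks * (M ^ J * sum_list (map (\<lambda>k. v k n) ks)))" .
  qed
  finally show ?thesis .
qed

definition jump_total :: real where
  "jump_total = (\<Sum>J=1..p-1. word_total J * (M ^ J * (real J * (2 * M))))"

lemma sum_jump_le: "(\<Sum>n=1..m. jump_bound N n) \<le> jump_total"
proof -
  have "(\<Sum>n=1..m. jump_bound N n) = (\<Sum>J=1..p-1. \<Sum>n=1..m. \<Sum>ks\<in>words N J. word_coeff ks * (M ^ J * sum_list (map (\<lambda>k. v k n) ks)))"
    unfolding jump_bound_def by (rule sum.swap)
  also have "\<dots> \<le> jump_total"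
    unfolding jump_total_def
  proof (rule sum_mono)
    fix J assume J: "J \<in> {1..p-1}"
    have "(\<Sum>n=1..m. \<Sum>ks\<in>words N J. word_coeff ks * (M ^ J * sum_list (map (\<lambda>k. v k n) ks)))
        = (\<Sum>ks\<in>words N J. word_coeff ks * (M ^ J * sum_list (map (\<lambda>k. \<Sum>n=1..m. v k n) ks)))"
      by (subst sum.swap) (simp only: sum_list_swap[symmetric] sum_distrib_left)
    also have "\<dots> \<le> (\<Sum>ks\<in>words N J. word_coeff ks * (M ^ J * (real J * (2 * M))))"
    proof (intro sum_mono mult_left_mono word_coeff_nonneg)
      fix ks assume "ks \<in> words N J"
      then have "length ks = J" by (simp add: words_def)
      then show "sum_list (map (\<lambda>k. \<Sum>n=1..m. v k n) ks) \<le> real J * (2 * M)"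
        using sum_list_le_length[of "\<lambda>k. \<Sum>n=1..m. v k n" "2 * M" ks, OF osc_sum] by simp
    qed (use M in auto)
    also have "\<dots> = sum word_coeff (words N J) * (M ^ J * (real J * (2 * M)))" by (simp add: sum_distrib_right)
    also have "\<dots> \<le> word_total J * (M ^ J * (real J * (2 * M)))"
      using J M by (intro mult_right_mono sum_word_coeff_le) auto
    finally show "(\<Sum>n=1..m. \<Sum>ks\<in>words N J. word_coeff ks * (M ^ J * sum_list (map (\<lambda>k. v k n) ks)))
        \<le> word_total J * (M ^ J * (real J * (2 * M)))" .
  qed
  finally show ?thesis .
qed

lemma \<gamma>_tendsto_0: "(\<lambda>n. cmod (\<gamma> k (real (Suc n)))) \<longlonglongrightarrow> 0"
proof -
  have "summable (\<lambda>n. cmod (\<gamma> k (real (Suc n))) ^ p)"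
  proof (rule summableI_nonneg_bounded)
    show "(\<Sum>i<n. cmod (\<gamma> k (real (Suc i))) ^ p) \<le> K" for n
      using pow_sum[of k n] by (simp add: sum.atLeast1_atMost_eq)
  qed simp
  then have "(\<lambda>n. cmod (\<gamma> k (real (Suc n))) ^ p) \<longlonglongrightarrow> 0" by (rule summable_LIMSEQ_zero)
  then show ?thesis using p by (subst (asm) power_tendsto_0_iff) auto
qed

lemma \<gamma>_prod_tendsto_0:
  assumes "ks \<noteq> []"
  shows "(\<lambda>n. \<gamma>_prod (Suc n) ks) \<longlonglongrightarrow> 0"
proof -
  obtain k l where ks: "ks = k # l" using assms by (cases ks) auto
  have lim: "(\<lambda>n. cmod (\<gamma> k (real (Suc n))) * M ^ length l) \<longlonglongrightarrow> 0"
    using tendsto_mult_right[OF \<gamma>_tendsto_0[of k], of "M ^ length l"] by simp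
  show ?thesis
  proof (rule real_tendsto_sandwich[OF _ _ tendsto_const lim])
    show "\<forall>\<^sub>F n in sequentially. 0 \<le> \<gamma>_prod (Suc n) ks" using \<gamma>_prod_bounds by (intro always_eventually allI) auto
    have "\<gamma>_prod (Suc n) ks \<le> cmod (\<gamma> k (real (Suc n))) * M ^ length l" for n
    proof -
      have "\<gamma>_prod (Suc n) ks = cmod (\<gamma> k (real (Suc n))) * \<gamma>_prod (Suc n) l" unfolding ks \<gamma>_prod_def by simp
      then show ?thesis using \<gamma>_prod_bounds[of "Suc n" l] by (simp add: mult_left_mono)
    qed
    then show "\<forall>\<^sub>F n in sequentially. \<gamma>_prod (Suc n) ks \<le> cmod (\<gamma> k (real (Suc n))) * M ^ length l"
      by (intro always_eventually allI)
  qed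
qed

text \<open>The supremum over \<open>k\<close> of \<open>|\<gamma> k n|\<close> need not tend to zero, but each \<open>\<gamma> k n\<close> does, and
  dominated convergence over the words gives the smallness of \<open>r\<close>.\<close>

lemma reflection_small:
  "\<forall>\<^sub>F n in sequentially. \<forall>N x. cmod (reflection \<eta> \<phi> (frozen n) N p x) \<le> 1/2"
proof -
  have "\<forall>\<^sub>F n in sequentially. \<forall>J\<in>{1..p-1}. \<forall>S. finite S \<and> S \<subseteq> {ks. length ks = J} \<longrightarrow>
      (\<Sum>ks\<in>S. word_coeff ks * \<gamma>_prod (Suc n) ks) \<le> 1 / (2 * real p)"
  proof (rule eventually_ball_finite)
    show "\<forall>J\<in>{1..p-1}. \<forall>\<^sub>F n in sequentially. \<forall>S. finite S \<and> S \<subseteq> {ks. length ks = J} \<longrightarrow>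
      (\<Sum>ks\<in>S. word_coeff ks * \<gamma>_prod (Suc n) ks) \<le> 1 / (2 * real p)"
    proof
      fix J assume J: "J \<in> {1..p-1}"
      show "\<forall>\<^sub>F n in sequentially. \<forall>S. finite S \<and> S \<subseteq> {ks. length ks = J} \<longrightarrow>
        (\<Sum>ks\<in>S. word_coeff ks * \<gamma>_prod (Suc n) ks) \<le> 1 / (2 * real p)"
      proof (rule uniform_tannery[where C = "M ^ J"])
        show "word_coeff summable_on {ks. length ks = J}" using J by (intro word_coeff_summable) auto
        show "(\<lambda>n. \<gamma>_prod (Suc n) ks) \<longlonglongrightarrow> 0" if "ks \<in> {ks. length ks = J}" for ks
          using that J by (intro \<gamma>_prod_tendsto_0) auto
        show "0 \<le> \<gamma>_prod (Suc n) ks" "\<gamma>_prod (Suc n) ks \<le> M ^ J" if "ks \<in> {ks. length ks = J}" for n ks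
          using \<gamma>_prod_bounds[of "Suc n" ks] that by auto
      qed (use p word_coeff_nonneg in auto)
    qed
  qed simp
  then have "\<forall>\<^sub>F n in sequentially. \<forall>N x. cmod (reflection \<eta> \<phi> (frozen (Suc n)) N p x) \<le> 1/2"
  proof eventually_elim
    case (elim n)
    show ?case
    proof (intro allI)
      fix N x
      have "cmod (reflection \<eta> \<phi> (frozen (Suc n)) N p x) \<le> (\<Sum>J=1..p-1. 1 / (2 * real p))"
        unfolding reflection_def
      proof (rule sum_norm_le)
        fix J assume J: "J \<in> {1..p-1}"
        have "words N J \<subseteq> {ks. length ks = J}" by (auto simp: words_def)
        then show "cmod (h_wave \<eta> \<phi> (frozen (Suc n)) N J x) \<le> 1 / (2 * real p)"
          using order_trans[OF cmod_h_wave_le] elim J by simp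
      qed
      also have "\<dots> = real (p - 1) / (2 * real p)" by simp
      also have "\<dots> \<le> 1/2" using p by (simp add: divide_simps)
      finally show "cmod (reflection \<eta> \<phi> (frozen (Suc n)) N p x) \<le> 1/2" .
    qed
  qed
  then show ?thesis by (rule eventually_sequentially_Suc[THEN iffD1])
qed


lemma a_tail_nonneg: "0 \<le> a_tail N"
  unfolding a_tail_def by (intro suminf_nonneg summable_ignore_initial_segment a_summable) simp

lemma wave_approx:
  assumes n: "1 \<le> n" "real n \<le> x" "x \<le> real n + 1"
    and W: "(\<lambda>k. a k * exp (- \<i> * of_real (\<phi> k) * of_real x) * \<gamma> k x) sums w"
  shows "cmod (wave \<phi> (frozen n) N x - w) \<le> (\<Sum>k<N. cmod (a k) * v k n) + M * a_tail N"
proof -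
  define f where "f k = a k * exp (- \<i> * of_real (\<phi> k) * of_real x) * \<gamma> k x" for k
  have x: "0 < x" using n by simp
  have f: "cmod (f k) \<le> cmod (a k) * M" for k
    unfolding f_def norm_mult norm_exp_phase using \<gamma>_le[OF x, of k] by (simp add: mult_left_mono)
  have "w = (\<Sum>k. f (k + N)) + (\<Sum>k<N. f k)"
    using sums_unique[OF W] suminf_split_initial_segment[OF sums_summable[OF W], of N] by (simp add: f_def)
  then have "wave \<phi> (frozen n) N x - w = (wave \<phi> (frozen n) N x - (\<Sum>k<N. f k)) - (\<Sum>k. f (k + N))" by simp
  also have "cmod \<dots> \<le> cmod (wave \<phi> (frozen n) N x - (\<Sum>k<N. f k)) + cmod (\<Sum>k. f (k + N))"
    by (rule norm_triangle_ineq4)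
  also have "\<dots> \<le> (\<Sum>k<N. cmod (a k) * v k n) + M * a_tail N"
  proof (rule add_mono)
    have "wave \<phi> (frozen n) N x - (\<Sum>k<N. f k) =
        (\<Sum>k<N. a k * exp (- \<i> * of_real (\<phi> k) * of_real x) * (\<gamma> k (real n) - \<gamma> k x))"
      unfolding wave_def f_def frozen_def sum_subtractf[symmetric] by (intro sum.cong refl) (simp add: algebra_simps)
    also have "cmod \<dots> \<le> (\<Sum>k<N. cmod (a k) * v k n)"
      using osc[OF n] by (intro sum_norm_le) (simp only: norm_mult norm_exp_phase mult_1_right norm_minus_commute, simp add: mult_left_mono)
    finally show "cmod (wave \<phi> (frozen n) N x - (\<Sum>k<N. f k)) \<le> (\<Sum>k<N. cmod (a k) * v k n)" .
    have sN: "summable (\<lambda>k. cmod (a (k + N)))" by (rule summable_ignore_initial_segment[OF a_summable])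
    have "cmod (\<Sum>k. f (k + N)) \<le> (\<Sum>k. cmod (a (k + N)) * M)"
      by (rule norm_suminf_le[OF f summable_mult2[OF sN]])
    also have "\<dots> = M * a_tail N" unfolding a_tail_def using suminf_mult2[OF sN, of M] by (simp add: mult.commute)
    finally show "cmod (\<Sum>k. f (k + N)) \<le> M * a_tail N" .
  qed
  finally show ?thesis .
qed

definition residual_bound :: "nat \<Rightarrow> nat \<Rightarrow> real" where
  "residual_bound N n = 4 * ((\<Sum>k<N. cmod (a k) * v k n) + M * a_tail N) + err_bound N n"

lemma residual_bound_nonneg:
  assumes "1 \<le> n"
  shows "0 \<le> residual_bound N n"
proof -
  have "0 \<le> (\<Sum>k<N. cmod (a k) * v k n)" using v_nonneg[OF assms] by (intro sum_nonneg) auto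
  moreover have "0 \<le> M * a_tail N" using M a_tail_nonneg by simp
  moreover have "0 \<le> err_bound N n" using cmod_reflection_error_le[OF assms, of N 0] norm_ge_zero by (rule order_trans[rotated])
  ultimately show ?thesis by (simp add: residual_bound_def)
qed

lemma jump_bound_nonneg: "1 \<le> n \<Longrightarrow> 0 \<le> jump_bound N n"
  using cmod_reflection_jump_le[of n N 0] norm_ge_zero by (rule order_trans[rotated])

lemma sum_residual_le:
  "(\<Sum>n=1..m. residual_bound N n) \<le> 4 * (a_total * (2 * M) + real m * (M * a_tail N)) + err_total"
proof -
  have "(\<Sum>n=1..m. \<Sum>k<N. cmod (a k) * v k n) = (\<Sum>k<N. cmod (a k) * (\<Sum>n=1..m. v k n))"
    by (subst sum.swap) (simp only: sum_distrib_left)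
  also have "\<dots> \<le> (\<Sum>k<N. cmod (a k) * (2 * M))"
    by (intro sum_mono mult_left_mono osc_sum norm_ge_zero)
  also have "\<dots> = (\<Sum>k<N. cmod (a k)) * (2 * M)" by (simp only: sum_distrib_right)
  also have "\<dots> \<le> a_total * (2 * M)" using M by (intro mult_right_mono sum_a_le) auto
  finally have "(\<Sum>n=1..m. \<Sum>k<N. cmod (a k) * v k n) \<le> a_total * (2 * M)" .
  then show ?thesis
    using sum_err_le[of N m] by (simp add: residual_bound_def sum.distrib sum_distrib_left[symmetric])
qed

text \<open>The energy is followed from one integer to the next. Within an interval it grows at most by
  the exponential of a multiple of the residual, at an integer by a factor governed by the jump of the
  frozen coefficients, and the product of all these factors is bounded.\<close>

lemma bloch_vector_bounded:
  fixes T X Y W :: "real \<Rightarrow> real"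
  assumes W: "\<And>x. 0 < x \<Longrightarrow>
      (\<lambda>k. a k * exp (- \<i> * of_real (\<phi> k) * of_real x) * \<gamma> k x) sums of_real (W x)"
    and AC: "\<And>s t. 0 < s \<Longrightarrow> abs_continuous_on {s..t} T"
      "\<And>s t. 0 < s \<Longrightarrow> abs_continuous_on {s..t} X"
      "\<And>s t. 0 < s \<Longrightarrow> abs_continuous_on {s..t} Y"
    and ode: "AE x in lborel. x > 0 \<longrightarrow>
        (T has_vector_derivative 4 * W x * Y x) (at x) \<and>
        (X has_vector_derivative \<eta> * Y x - 2 * W x * Y x) (at x) \<and>
        (Y has_vector_derivative - \<eta> * X x + W x * (T x + 2 * X x)) (at x)"
    and cone: "\<And>x. 0 \<le> T x" "\<And>x. 4 * ((X x)\<^sup>2 + (Y x)\<^sup>2) \<le> (T x)\<^sup>2"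
  shows "\<exists>x0>0. \<exists>C. \<forall>x\<ge>x0. T x \<le> C"
proof -
  obtain n1 where n1: "\<And>n N x. n1 \<le> n \<Longrightarrow> cmod (reflection \<eta> \<phi> (frozen n) N p x) \<le> 1/2"
    using reflection_small unfolding eventually_sequentially by blast
  \<comment> \<open>From \<open>n0\<close> on, \<open>r\<close> stays in the disc of radius \<open>1/2\<close> for every cutoff.\<close>
  define n0 where "n0 = max 1 n1"
  have n0: "1 \<le> n0" and small: "\<And>n N x. n0 \<le> n \<Longrightarrow> cmod (reflection \<eta> \<phi> (frozen n) N p x) \<le> 1/2"
    using n1 by (auto simp: n0_def)
  define Q where "Q = 27 * jump_total + 24 * (4 * (a_total * (2 * M) + 1) + err_total)"
  have main: "T x \<le> 9 * exp Q * T (real n0)" if x: "real n0 \<le> x" for x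
  proof -
    define m where "m = nat \<lfloor>x\<rfloor>"
    have m: "real m \<le> x" "x \<le> real m + 1" "n0 \<le> m"
      using x n0 unfolding m_def by linarith+
    have pos: "0 < 1 / (real (Suc m) * M)" using M by simp
    \<comment> \<open>The cutoff depends on \<open>x\<close>: the neglected part of the potential need not be integrable
      on the half-line, but the bound for its integral up to \<open>m\<close> is made at most one.\<close>
    obtain N where N: "norm (\<Sum>k. cmod (a (k + N))) < 1 / (real (Suc m) * M)"
      using suminf_exist_split[OF pos a_summable] by blast
    then have tl: "real m * (M * a_tail N) \<le> 1"
    proof -
      have "a_tail N \<le> 1 / (real (Suc m) * M)" using N by (simp add: a_tail_def)
      then have "a_tail N * (real (Suc m) * M) \<le> 1" using M by (simp add: pos_le_divide_eq)
      moreover have "real m * (M * a_tail N) \<le> a_tail N * (real (Suc m) * M)"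
        using M a_tail_nonneg[of N] by (simp add: algebra_simps)
      ultimately show ?thesis by linarith
    qed
    define r where "r n = reflection \<eta> \<phi> (frozen n) N p" for n
    define S where "S n y = energy (T y) (X y) (Y y) (r n y)" for n y
    have rs: "cmod (r n y) \<le> 1/2" if "n0 \<le> n" for n y using small[OF that] by (simp add: r_def)
    have S0: "0 \<le> S n y" if "n0 \<le> n" for n y
      using energy_bounds(1)[OF cone rs[OF that], of y y] cone(1)[of y] unfolding S_def by linarith
    define G where "G n = exp (27 * jump_bound N n + 24 * residual_bound N n)" for n
    have step: "S n y \<le> S n (real n) * exp (24 * residual_bound N n)"
      if n: "n0 \<le> n" and y: "real n \<le> y" "y \<le> real n + 1" for n y
    proof -
      have n1: "1 \<le> n" using n n0 by simp
      define r' where "r' t = - \<i> * of_real \<eta> * r n t + \<i> * wave \<phi> (frozen n) N t * (1 + r n t)\<^sup>2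
          - \<i> * reflection_error \<eta> \<phi> (frozen n) N p t" for t
      have "S n y \<le> S n (real n) * exp (24 * residual_bound N n * (y - real n))"
        unfolding S_def
      proof (rule energy_step[where W = W and \<eta> = \<eta> and r' = r'])
        show "abs_continuous_on {real n..y} T" "abs_continuous_on {real n..y} X" "abs_continuous_on {real n..y} Y"
          using AC n1 by auto
        show "AE t in lborel. t \<in> {real n..y} \<longrightarrow>
          (T has_vector_derivative 4 * W t * Y t) (at t) \<and>
          (X has_vector_derivative \<eta> * Y t - 2 * W t * Y t) (at t) \<and>
          (Y has_vector_derivative - \<eta> * X t + W t * (T t + 2 * X t)) (at t)"
          using ode by eventually_elim (use n1 in auto)
        show "(r n has_vector_derivative r' t) (at t)" for t
          unfolding r_def r'_def
        proof (rule reflection_deriv)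
          show "\<eta> - sum_list (map \<phi> ks) \<noteq> 0" if "J \<in> {1..p-1}" "ks \<in> words N J" for J ks
            by (rule denominators) (use that in \<open>simp add: words_def\<close>)
        qed (use p in simp)
        show "continuous_on {real n..y} r'"
          unfolding r'_def r_def
          by (intro continuous_intros continuous_on_reflection continuous_on_wave continuous_on_reflection_error)
        show "cmod (r' t - (- \<i> * of_real \<eta> * r n t + \<i> * of_real (W t) * (1 + r n t)\<^sup>2)) \<le> residual_bound N n"
          if t: "t \<in> {real n..y}" for t
        proof -
          have t': "real n \<le> t" "t \<le> real n + 1" "0 < t" using t y n1 by auto
          have one: "(cmod (1 + r n t))\<^sup>2 \<le> 4"
          proof -
            have "cmod (1 + r n t) \<le> 2"
              using norm_triangle_ineq[of 1 "r n t"] rs[OF n, of t] by simp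
            then show ?thesis using power_mono[of "cmod (1 + r n t)" 2 2] by simp
          qed
          have wv: "cmod (wave \<phi> (frozen n) N t - of_real (W t)) \<le> (\<Sum>k<N. cmod (a k) * v k n) + M * a_tail N"
            by (rule wave_approx[OF n1 t'(1,2) W[OF t'(3)]])
          have "r' t - (- \<i> * of_real \<eta> * r n t + \<i> * of_real (W t) * (1 + r n t)\<^sup>2)
              = \<i> * ((1 + r n t)\<^sup>2 * (wave \<phi> (frozen n) N t - of_real (W t))) - \<i> * reflection_error \<eta> \<phi> (frozen n) N p t"
            unfolding r'_def by (simp add: left_diff_distrib right_diff_distrib mult_ac)
          also have "cmod \<dots> \<le> (cmod (1 + r n t))\<^sup>2 * cmod (wave \<phi> (frozen n) N t - of_real (W t))
              + cmod (reflection_error \<eta> \<phi> (frozen n) N p t)"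
            by (rule order_trans[OF norm_triangle_ineq4]) (simp add: norm_mult norm_power)
          also have "\<dots> \<le> residual_bound N n"
            unfolding residual_bound_def
            by (intro add_mono mult_mono one wv cmod_reflection_error_le n1 norm_ge_zero) simp
          finally show ?thesis .
        qed
      qed (use y cone rs[OF n] in auto)
      also have "\<dots> \<le> S n (real n) * exp (24 * residual_bound N n)"
        using y residual_bound_nonneg[OF n1, of N] S0[OF n] by (intro mult_left_mono) (auto intro: mult_left_le)
      finally show ?thesis .
    qed
    have iterate: "S (n0 + i) (real (n0 + i)) \<le> S n0 (real n0) * (\<Prod>n\<in>{n0..<n0+i}. G n)" for i
    proof (induction i)
      case (Suc i)
      define n where "n = n0 + i"
      have n: "n0 \<le> n" "1 \<le> n" using n0 by (auto simp: n_def)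
      let ?y = "real (Suc n)"
      have jn: "cmod (r (Suc n) ?y - r n ?y) \<le> jump_bound N n"
        unfolding r_def by (rule cmod_reflection_jump_le[OF n(2)])
      have "S (Suc n) ?y \<le> (1 + 27 * cmod (r (Suc n) ?y - r n ?y)) * S n ?y"
        unfolding S_def by (rule energy_jump[OF cone rs rs]) (use n in auto)
      also have "\<dots> \<le> exp (27 * jump_bound N n) * (S n (real n) * exp (24 * residual_bound N n))"
      proof (rule mult_mono)
        have "1 + 27 * cmod (r (Suc n) ?y - r n ?y) \<le> 1 + 27 * jump_bound N n" using jn by simp
        also have "\<dots> \<le> exp (27 * jump_bound N n)" by (rule exp_ge_add_one_self)
        finally show "1 + 27 * cmod (r (Suc n) ?y - r n ?y) \<le> exp (27 * jump_bound N n)" .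
        show "S n ?y \<le> S n (real n) * exp (24 * residual_bound N n)" by (rule step[OF n(1)]) auto
      qed (use S0[OF n(1)] in auto)
      also have "\<dots> = S n (real n) * G n" by (simp add: G_def exp_add mult_ac)
      also have "\<dots> \<le> (S n0 (real n0) * (\<Prod>n\<in>{n0..<n0+i}. G n)) * G n"
        using Suc unfolding n_def by (intro mult_right_mono) (auto simp: G_def)
      finally show ?case by (simp add: n_def mult.assoc)
    qed simp
    have "(\<Prod>n\<in>{n0..<m}. G n) * exp (24 * residual_bound N m) \<le> (\<Prod>n\<in>{n0..<m}. G n) * G m"
      unfolding G_def using jump_bound_nonneg[of m N] m(3) n0 by (intro mult_left_mono prod_nonneg) auto
    also have "\<dots> = (\<Prod>n\<in>{n0..<Suc m}. G n)" using m(3) by simp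
    also have "\<dots> = exp (\<Sum>n\<in>{n0..<Suc m}. 27 * jump_bound N n + 24 * residual_bound N n)"
      unfolding G_def by (rule exp_sum[symmetric]) simp
    also have "\<dots> \<le> exp Q"
    proof -
      have "(\<Sum>n\<in>{n0..<Suc m}. 27 * jump_bound N n + 24 * residual_bound N n)
          \<le> (\<Sum>n=1..m. 27 * jump_bound N n + 24 * residual_bound N n)"
        using n0 jump_bound_nonneg residual_bound_nonneg by (intro sum_mono2) auto
      also have "\<dots> = 27 * (\<Sum>n=1..m. jump_bound N n) + 24 * (\<Sum>n=1..m. residual_bound N n)"
        by (simp add: sum.distrib sum_distrib_left)
      also have "\<dots> \<le> Q"
      proof -
        have "4 * (a_total * (2 * M) + real m * (M * a_tail N)) + err_total \<le> 4 * (a_total * (2 * M) + 1) + err_total"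
          by (intro add_mono mult_left_mono tl order.refl) simp
        with sum_residual_le[of N m]
        have "(\<Sum>n=1..m. residual_bound N n) \<le> 4 * (a_total * (2 * M) + 1) + err_total" by (rule order_trans)
        then show ?thesis
          unfolding Q_def using sum_jump_le[of N m] by (intro add_mono mult_left_mono) auto
      qed
      finally show ?thesis by simp
    qed
    finally have GQ: "(\<Prod>n\<in>{n0..<m}. G n) * exp (24 * residual_bound N m) \<le> exp Q" .
    have "T x \<le> 3 * S m x"
      unfolding S_def by (rule energy_bounds(1)[OF cone rs[OF m(3)]])
    also have "S m x \<le> S m (real m) * exp (24 * residual_bound N m)" by (rule step[OF m(3,1,2)])
    also have "S m (real m) \<le> S n0 (real n0) * (\<Prod>n\<in>{n0..<m}. G n)"
      using iterate[of "m - n0"] m(3) by simp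
    finally have 1: "T x \<le> 3 * (S n0 (real n0) * (\<Prod>n\<in>{n0..<m}. G n) * exp (24 * residual_bound N m))" by simp
    have 2: "S n0 (real n0) * (\<Prod>n\<in>{n0..<m}. G n) * exp (24 * residual_bound N m) \<le> S n0 (real n0) * exp Q"
      using mult_left_mono[OF GQ S0[of n0 "real n0"]] by (simp add: mult.assoc)
    have 3: "S n0 (real n0) * exp Q \<le> 3 * T (real n0) * exp Q"
      unfolding S_def by (intro mult_right_mono energy_bounds(2)[OF cone rs]) auto
    have "T x \<le> 3 * (3 * T (real n0) * exp Q)"
      by (rule order_trans[OF 1 mult_left_mono[OF order_trans[OF 2 3]]]) simp
    then show ?thesis by (simp add: mult_ac)
  qed
  show ?thesis using main n0 by (intro exI[of _ "real n0"] conjI exI[of _ "9 * exp Q * T (real n0)"]) auto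
qed

end

section \<open>Bounded variation and power integrability at the integers\<close>

lemma ennreal_finite_cases:
  assumes "(x :: ennreal) < \<infinity>"
  obtains r where "x = ennreal r" "0 \<le> r"
  using assms by (cases x rule: ennreal_cases) auto

lemma sum_increments_le_variation:
  assumes var: "variation f I \<le> ennreal M" and M: "0 \<le> M" and xs: "sorted xs" "set xs \<subseteq> I"
  shows "(\<Sum>i<length xs - 1. norm (f (xs ! Suc i) - f (xs ! i))) \<le> M"
proof -
  have "ennreal (\<Sum>i<length xs - 1. norm (f (xs ! Suc i) - f (xs ! i)))
      = (\<Sum>i<length xs - 1. ennreal (norm (f (xs ! Suc i) - f (xs ! i))))"
    by (rule sum_ennreal[symmetric]) simp
  also have "\<dots> \<le> variation f I"
    unfolding variation_def using xs by (intro SUP_upper) auto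
  also note var
  finally show ?thesis using M by (simp add: ennreal_le_iff)
qed

lemma increment_le_variation:
  assumes "variation f I \<le> ennreal M" "0 \<le> M" "x \<in> I" "y \<in> I"
  shows "norm (f y - f x) \<le> M"
proof -
  have *: "norm (f t - f s) \<le> M" if "s \<le> t" "s \<in> I" "t \<in> I" for s t
    using sum_increments_le_variation[OF assms(1,2), of "[s, t]"] that by simp
  show ?thesis
    using *[of x y] *[of y x] assms(3,4) by (cases "x \<le> y") (auto simp: norm_minus_commute)
qed

text \<open>The points \<open>1, y 1, 2, y 2, \<dots>, m, y m\<close> are in increasing order, and the increments in question are
  every other increment along this list.\<close>

lemma sum_unit_interval_increments_le_variation:
  fixes y :: "nat \<Rightarrow> real"
  assumes var: "variation f {0<..} \<le> ennreal M" and M: "0 \<le> M"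
    and y: "\<And>n. real n \<le> y n \<and> y n \<le> real n + 1"
  shows "(\<Sum>n=1..m. norm (f (y n) - f (real n))) \<le> M"
proof -
  define g where "g i = (if even i then real (i div 2 + 1) else y (i div 2 + 1))" for i
  define xs where "xs = map g [0..<2 * m]"
  have g: "g i \<le> g (Suc i) \<and> 0 < g i" for i
  proof (cases "even i")
    case True
    then show ?thesis using y[of "i div 2 + 1"] by (simp add: g_def)
  next
    case False
    then have "Suc i div 2 = i div 2 + 1" by presburger
    then show ?thesis using False y[of "i div 2 + 1"] by (auto simp: g_def)
  qed
  have "sorted xs" unfolding xs_def by (simp add: sorted_iff_nth_Suc g)
  moreover have "set xs \<subseteq> {0<..}" unfolding xs_def using g by auto
  ultimately have le: "(\<Sum>i<length xs - 1. norm (f (xs ! Suc i) - f (xs ! i))) \<le> M"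
    by (rule sum_increments_le_variation[OF var M])
  have "(\<Sum>n=1..m. norm (f (y n) - f (real n))) = (\<Sum>j<m. norm (f (g (Suc (2 * j))) - f (g (2 * j))))"
    by (rule sum.reindex_bij_witness[of _ Suc "\<lambda>n. n - 1"]) (auto simp: g_def)
  also have "\<dots> = (\<Sum>i\<in>(\<lambda>j. 2 * j) ` {..<m}. norm (f (g (Suc i)) - f (g i)))"
    by (subst sum.reindex) (auto simp: inj_on_def)
  also have "\<dots> \<le> (\<Sum>i<2 * m - 1. norm (f (g (Suc i)) - f (g i)))"
    by (rule sum_mono2) auto
  also have "\<dots> = (\<Sum>i<length xs - 1. norm (f (xs ! Suc i) - f (xs ! i)))"
    by (rule sum.cong) (auto simp: xs_def)
  finally show ?thesis using le by simp
qed

lemma sum_oscillation_le_variation: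
  fixes f :: "real \<Rightarrow> 'a::real_normed_vector"
  assumes var: "variation f {0<..} \<le> ennreal M" and M: "0 \<le> M"
  shows "\<exists>v :: nat \<Rightarrow> real.
    (\<forall>n x. 1 \<le> n \<longrightarrow> real n \<le> x \<longrightarrow> x \<le> real n + 1 \<longrightarrow> norm (f x - f (real n)) \<le> v n) \<and>
    (\<forall>n\<ge>1. v n \<le> M) \<and> (\<forall>m. (\<Sum>n=1..m. v n) \<le> 2 * M)"
proof -
  define w where "w n x = norm (f x - f (real n))" for n x
  define v where "v n = (SUP x\<in>{real n..real n + 1}. w n x)" for n
  have wM: "w n x \<le> M" if "1 \<le> n" "x \<in> {real n..real n + 1}" for n x
    unfolding w_def by (rule increment_le_variation[OF var M]) (use that in auto)
  have bdd: "bdd_above (w n ` {real n..real n + 1})" if "1 \<le> n" for n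
    using wM[OF that] by (intro bdd_aboveI2)
  have up: "w n x \<le> v n" if "1 \<le> n" "x \<in> {real n..real n + 1}" for n x
    unfolding v_def by (rule cSUP_upper[OF that(2) bdd[OF that(1)]])
  \<comment> \<open>The supremum may fail to be attained; half of it is attained, which costs the factor \<open>2\<close>.\<close>
  have "\<exists>x. real n \<le> x \<and> x \<le> real n + 1 \<and> (1 \<le> n \<longrightarrow> v n \<le> 2 * w n x)" for n
  proof (cases "1 \<le> n \<and> 0 < v n")
    case True
    then have "v n / 2 < v n" by simp
    then obtain x where "x \<in> {real n..real n + 1}" "v n / 2 < w n x"
      using less_cSUP_iff[OF _ bdd, of n "v n / 2"] True unfolding v_def[symmetric] by auto
    then show ?thesis by (intro exI[of _ x]) auto
  next
    case False
    then show ?thesis by (intro exI[of _ "real n"]) (auto simp: w_def not_less)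
  qed
  then obtain y where y: "\<And>n. real n \<le> y n \<and> y n \<le> real n + 1" "\<And>n. 1 \<le> n \<Longrightarrow> v n \<le> 2 * w n (y n)"
    by metis
  show ?thesis
  proof (intro exI[of _ v] conjI allI impI)
    show "norm (f x - f (real n)) \<le> v n" if "1 \<le> n" "real n \<le> x" "x \<le> real n + 1" for n x
      using up[of n x] that by (simp add: w_def)
    show "v n \<le> M" if "1 \<le> n" for n
      unfolding v_def using wM[OF that] by (intro cSUP_least) auto
    show "(\<Sum>n=1..m. v n) \<le> 2 * M" for m
    proof -
      have "(\<Sum>n=1..m. v n) \<le> (\<Sum>n=1..m. 2 * w n (y n))" using y(2) by (intro sum_mono) auto
      also have "\<dots> = 2 * (\<Sum>n=1..m. norm (f (y n) - f (real n)))" by (simp add: w_def sum_distrib_left)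
      also have "\<dots> \<le> 2 * M" using sum_unit_interval_increments_le_variation[OF var M y(1)] by simp
      finally show ?thesis .
    qed
  qed
qed

text \<open>Comparison of \<open>F\<close> with the step function of value \<open>c n\<close> on the interval from \<open>n\<close> to \<open>n + 1\<close>.\<close>

lemma sum_unit_intervals_le_nn_integral:
  fixes c :: "nat \<Rightarrow> ennreal" and F :: "real \<Rightarrow> ennreal"
  assumes c: "\<And>n x. 1 \<le> n \<Longrightarrow> real n \<le> x \<Longrightarrow> x < real n + 1 \<Longrightarrow> c n \<le> F x"
  shows "(\<Sum>n=1..m. c n) \<le> (\<integral>\<^sup>+x\<in>{0<..}. F x \<partial>lborel)"
proof -
  have "(\<Sum>n=1..m. c n) = (\<Sum>n=1..m. \<integral>\<^sup>+x. c n * indicator {real n..<real n + 1} x \<partial>lborel)"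
    by (simp add: nn_integral_cmult_indicator)
  also have "\<dots> = (\<integral>\<^sup>+x. (\<Sum>n=1..m. c n * indicator {real n..<real n + 1} x) \<partial>lborel)"
    by (rule nn_integral_sum[symmetric]) simp
  also have "\<dots> \<le> (\<integral>\<^sup>+x. F x * indicator {0<..} x \<partial>lborel)"
  proof (rule nn_integral_mono)
    fix x :: real
    define k where "k = nat \<lfloor>x\<rfloor>"
    have only: "n = k" if "real n \<le> x" "x < real n + 1" for n
      using that unfolding k_def by linarith
    have "(\<Sum>n=1..m. c n * indicator {real n..<real n + 1} x) =
        (\<Sum>n\<in>{1..m} \<inter> {k}. c n * indicator {real n..<real n + 1} x)"
      using only by (intro sum.mono_neutral_right) (auto simp: indicator_def)
    also have "\<dots> \<le> F x * indicator {0<..} x"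
    proof (cases "k \<in> {1..m} \<and> x \<in> {real k..<real k + 1}")
      case True
      then have "{1..m} \<inter> {k} = {k}" "0 < x" by auto
      then show ?thesis using c[of k x] True by simp
    next
      case False
      then have "(\<Sum>n\<in>{1..m} \<inter> {k}. c n * indicator {real n..<real n + 1} x) = 0"
        by (intro sum.neutral) (auto simp: indicator_def)
      then show ?thesis by simp
    qed
    finally show "(\<Sum>n=1..m. c n * indicator {real n..<real n + 1} x) \<le> F x * indicator {0<..} x" .
  qed
  finally show ?thesis .
qed

text \<open>Bounded variation makes a limit at infinity exist, and integrability forces it to be zero, so
  the total variation also bounds the function.\<close>

lemma norm_le_variation:
  fixes f :: "real \<Rightarrow> complex" and F :: "real \<Rightarrow> ennreal"
  assumes var: "variation f {0<..} \<le> ennreal M" and M: "0 \<le> M"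
    and F: "\<And>x. 0 < x \<Longrightarrow> ennreal (cmod (f x)) ^ p \<le> F x"
    and fin: "(\<integral>\<^sup>+x\<in>{0<..}. F x \<partial>lborel) < \<infinity>" and x: "0 < x"
  shows "cmod (f x) \<le> M"
proof (rule ccontr)
  assume "\<not> cmod (f x) \<le> M"
  define d where "d = cmod (f x) - M"
  have d: "0 < d" using \<open>\<not> cmod (f x) \<le> M\<close> by (simp add: d_def)
  have lower: "d \<le> cmod (f y)" if "0 < y" for y
    using increment_le_variation[OF var M, of x y] that x norm_triangle_ineq2[of "f x" "f y"]
    by (simp add: d_def norm_minus_commute)
  have "of_nat m * ennreal (d ^ p) \<le> (\<integral>\<^sup>+x\<in>{0<..}. F x \<partial>lborel)" for m
  proof -
    have "(\<Sum>n=1..m. ennreal (d ^ p)) \<le> (\<integral>\<^sup>+x\<in>{0<..}. F x \<partial>lborel)"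
    proof (rule sum_unit_intervals_le_nn_integral)
      fix n :: nat and y :: real assume "1 \<le> n" "real n \<le> y"
      then have y: "0 < y" by simp
      have "ennreal (d ^ p) \<le> ennreal (cmod (f y)) ^ p"
        using lower[OF y] d by (simp add: ennreal_power power_mono)
      then show "ennreal (d ^ p) \<le> F y" using F[OF y] by (rule order_trans)
    qed
    then show ?thesis by simp
  qed
  moreover obtain I where I: "(\<integral>\<^sup>+x\<in>{0<..}. F x \<partial>lborel) = ennreal I" "0 \<le> I"
    by (rule ennreal_finite_cases[OF fin])
  ultimately have le: "real m * d ^ p \<le> I" for m
    using d by (simp add: ennreal_of_nat_eq_real_of_nat ennreal_mult[symmetric] ennreal_le_iff)
  obtain m :: nat where "I / d ^ p < real m" using reals_Archimedean2 by blast
  then have "I < real m * d ^ p" using d by (simp add: pos_divide_less_eq)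
  then show False using le[of m] by simp
qed

text \<open>On the interval from \<open>n\<close> to \<open>n + 1\<close> the function is at least \<open>|f n| - v n\<close> in modulus. The \<open>p\<close>-th
  powers of these lower bounds are summed by the integral, and those of the \<open>v n\<close> by the variation.\<close>

lemma sum_samples_power_le:
  fixes f :: "real \<Rightarrow> complex" and F :: "real \<Rightarrow> ennreal" and v :: "nat \<Rightarrow> real"
  assumes osc: "\<And>n x. 1 \<le> n \<Longrightarrow> real n \<le> x \<Longrightarrow> x \<le> real n + 1 \<Longrightarrow> cmod (f x - f (real n)) \<le> v n"
    and v: "\<And>n. 1 \<le> n \<Longrightarrow> v n \<le> M" "\<And>m. (\<Sum>n=1..m. v n) \<le> 2 * M" and M: "0 \<le> M"
    and F: "\<And>x. 0 < x \<Longrightarrow> ennreal (cmod (f x)) ^ p \<le> F x"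
    and int: "(\<integral>\<^sup>+x\<in>{0<..}. F x \<partial>lborel) \<le> ennreal I" and I: "0 \<le> I" and p: "1 \<le> p"
  shows "(\<Sum>n=1..m. cmod (f (real n)) ^ p) \<le> 2 ^ p * (I + M ^ (p - 1) * (2 * M))"
proof -
  define c where "c n = max 0 (cmod (f (real n)) - v n)" for n
  have v0: "0 \<le> v n" if "1 \<le> n" for n using osc[of n "real n"] that by simp
  have "ennreal (\<Sum>n=1..m. c n ^ p) = (\<Sum>n=1..m. ennreal (c n ^ p))"
    by (rule sum_ennreal[symmetric]) (simp add: c_def)
  also have "\<dots> \<le> (\<integral>\<^sup>+x\<in>{0<..}. F x \<partial>lborel)"
  proof (rule sum_unit_intervals_le_nn_integral)
    fix n :: nat and x :: real assume n: "1 \<le> n" "real n \<le> x" "x < real n + 1"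
    have "c n \<le> cmod (f x)"
      using osc[of n x] n norm_triangle_ineq2[of "f (real n)" "f x"] by (simp add: c_def norm_minus_commute)
    then have "ennreal (c n ^ p) \<le> ennreal (cmod (f x)) ^ p"
      by (simp add: ennreal_power power_mono c_def)
    also have "\<dots> \<le> F x" using n by (intro F) auto
    finally show "ennreal (c n ^ p) \<le> F x" .
  qed
  also note int
  finally have sc: "(\<Sum>n=1..m. c n ^ p) \<le> I" using I by (simp add: ennreal_le_iff)
  have "(\<Sum>n=1..m. cmod (f (real n)) ^ p) \<le> (\<Sum>n=1..m. 2 ^ p * (c n ^ p + M ^ (p - 1) * v n))"
  proof (rule sum_mono)
    fix n assume "n \<in> {1..m}"
    then have n: "1 \<le> n" by simp
    define y where "y = max (c n) (v n)"
    have "c n \<le> y" "v n \<le> y" "cmod (f (real n)) \<le> c n + v n" by (auto simp: y_def c_def)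
    then have y: "0 \<le> y" "cmod (f (real n)) \<le> 2 * y" using v0[OF n] by linarith+
    have vp: "v n ^ p \<le> M ^ (p - 1) * v n"
    proof -
      have "v n ^ p = v n ^ (p - 1) * v n" using p by (cases p) auto
      also have "\<dots> \<le> M ^ (p - 1) * v n" using v0[OF n] v(1)[OF n] by (intro mult_right_mono power_mono) auto
      finally show ?thesis .
    qed
    have "cmod (f (real n)) ^ p \<le> (2 * y) ^ p" using y by (intro power_mono) auto
    also have "\<dots> = 2 ^ p * y ^ p" by (rule power_mult_distrib)
    also have "\<dots> \<le> 2 ^ p * (c n ^ p + v n ^ p)"
      using v0[OF n] by (intro mult_left_mono) (auto simp: y_def max_def c_def)
    also have "\<dots> \<le> 2 ^ p * (c n ^ p + M ^ (p - 1) * v n)" using vp by simp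
    finally show "cmod (f (real n)) ^ p \<le> 2 ^ p * (c n ^ p + M ^ (p - 1) * v n)" .
  qed
  also have "\<dots> = 2 ^ p * ((\<Sum>n=1..m. c n ^ p) + M ^ (p - 1) * (\<Sum>n=1..m. v n))"
    by (simp only: sum.distrib sum_distrib_left distrib_left)
  also have "\<dots> \<le> 2 ^ p * (I + M ^ (p - 1) * (2 * M))"
    using sc v(2)[of m] M by (intro mult_left_mono add_mono) auto
  finally show ?thesis .
qed

section \<open>Boundedness of all solutions\<close>

lemma prod_list_map_divide:
  fixes c :: "nat \<Rightarrow> complex"
  shows "prod_list (map (\<lambda>k. c k / w) ks) = prod_list (map c ks) / w ^ length ks"
  by (induction ks) (simp_all add: field_simps)

theorem lemma1p3:
  fixes V :: "real \<Rightarrow> real" and c :: "nat \<Rightarrow> complex" and \<phi> :: "nat \<Rightarrow> real"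
    and \<gamma> :: "nat \<Rightarrow> real \<Rightarrow> complex" and \<eta> E :: real and p :: nat
  assumes V: "\<And>x. x > 0 \<Longrightarrow>
      (\<lambda>k. c k * exp (- \<i> * of_real (\<phi> k) * of_real x) * \<gamma> k x) sums of_real (V x)"
    and eta: "\<eta> > 0"
    and bv: "(SUP k. variation (\<gamma> k) {0<..}) < \<infinity>"
    and p: "p \<ge> 2"
    and Lp: "(\<integral>\<^sup>+x\<in>{0<..}. (SUP k. ennreal (norm (\<gamma> k x))) ^ p \<partial>lborel) < \<infinity>"
    and c: "summable (\<lambda>k. norm (c k))"
    and h_fin: "\<And>j ks. j \<in> {1..p - 1} \<Longrightarrow> length ks = j \<Longrightarrow> h_finite \<eta> (map \<phi> ks)"
    and h_sum: "\<And>j. j \<in> {1..p - 1} \<Longrightarrow>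
      (\<lambda>ks. norm (prod_list (map c ks) * of_real (h \<eta> (map \<phi> ks))))
        summable_on {ks. length ks = j}"
    and E: "E = \<eta>\<^sup>2 / 4"
  shows "\<forall>u. is_solution V E u \<longrightarrow> bounded (u ` {0<..})"
proof (intro allI impI)
  fix u assume sol: "is_solution V E u"
  define F where "F x = (SUP k. ennreal (norm (\<gamma> k x))) ^ p" for x
  obtain M0 where M0: "(SUP k. variation (\<gamma> k) {0<..}) = ennreal M0"
    by (rule ennreal_finite_cases[OF bv])
  define M where "M = max 1 M0"
  have M: "1 \<le> M" "0 \<le> M" by (auto simp: M_def)
  have var: "variation (\<gamma> k) {0<..} \<le> ennreal M" for k
  proof -
    have "variation (\<gamma> k) {0<..} \<le> ennreal M0" unfolding M0[symmetric] by (rule SUP_upper) simp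
    also have "\<dots> \<le> ennreal M" by (rule ennreal_leI) (simp add: M_def)
    finally show ?thesis .
  qed
  have F: "ennreal (cmod (\<gamma> k x)) ^ p \<le> F x" for k x
    unfolding F_def by (intro power_mono SUP_upper) auto
  obtain I where I: "(\<integral>\<^sup>+x\<in>{0<..}. F x \<partial>lborel) = ennreal I" "0 \<le> I"
    by (rule ennreal_finite_cases[OF Lp[folded F_def]])
  define osc_bound where "osc_bound k w \<longleftrightarrow>
      (\<forall>n x. 1 \<le> n \<longrightarrow> real n \<le> x \<longrightarrow> x \<le> real n + 1 \<longrightarrow> cmod (\<gamma> k x - \<gamma> k (real n)) \<le> w n) \<and>
      (\<forall>n\<ge>1. w n \<le> M) \<and> (\<forall>m. (\<Sum>n=1..m. w n) \<le> 2 * M)" for k and w :: "nat \<Rightarrow> real"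
  have "\<exists>w. osc_bound k w" for k
    unfolding osc_bound_def by (rule sum_oscillation_le_variation[OF var M(2)])
  then have "\<forall>k. \<exists>w. osc_bound k w" by (rule allI)
  from choice[OF this] obtain v where ob: "\<forall>k. osc_bound k (v k)" ..
  have v: "\<And>n x. 1 \<le> n \<Longrightarrow> real n \<le> x \<Longrightarrow> x \<le> real n + 1 \<Longrightarrow> cmod (\<gamma> k x - \<gamma> k (real n)) \<le> v k n"
    "\<And>n. 1 \<le> n \<Longrightarrow> v k n \<le> M" "\<And>m. (\<Sum>n=1..m. v k n) \<le> 2 * M" for k
    using ob[rule_format, of k] unfolding osc_bound_def by simp_all
  define a where "a k = c k / of_real \<eta>" for k
  interpret frozen_potential a \<phi> \<gamma> \<eta> M "2 ^ p * (I + M ^ (p - 1) * (2 * M))" p v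
  proof
    show "cmod (\<gamma> k x) \<le> M" if "0 < x" for k x
      by (rule norm_le_variation[OF var M(2) F _ that]) (use I in simp)
    show "(\<Sum>n=1..m. cmod (\<gamma> k (real n)) ^ p) \<le> 2 ^ p * (I + M ^ (p - 1) * (2 * M))" for k m
      by (rule sum_samples_power_le[OF v M(2) F _ I(2)]) (use I p in auto)
    show "summable (\<lambda>k. cmod (a k))"
      unfolding a_def norm_divide by (rule summable_divide[OF c])
    show "\<eta> - sum_list (map \<phi> ks) \<noteq> 0" if "length ks \<in> {1..p-1}" for ks
      using h_fin[OF that refl] that by (subst (asm) h_finite.simps) auto
    show "(\<lambda>ks. cmod (prod_list (map a ks)) * \<bar>h \<eta> (map \<phi> ks)\<bar>) summable_on {ks. length ks = J}"
      if "J \<in> {1..p-1}" for J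
    proof -
      have "(\<lambda>ks. (1 / \<eta> ^ J) * norm (prod_list (map c ks) * of_real (h \<eta> (map \<phi> ks))))
          summable_on {ks. length ks = J}"
        by (intro summable_on_cmult_right h_sum that)
      also have "(\<lambda>ks. (1 / \<eta> ^ J) * norm (prod_list (map c ks) * of_real (h \<eta> (map \<phi> ks))))
            summable_on {ks. length ks = J} \<longleftrightarrow>
          (\<lambda>ks. cmod (prod_list (map a ks)) * \<bar>h \<eta> (map \<phi> ks)\<bar>) summable_on {ks. length ks = J}"
      proof (rule summable_on_cong)
        show "(1 / \<eta> ^ J) * norm (prod_list (map c ks) * of_real (h \<eta> (map \<phi> ks)))
          = cmod (prod_list (map a ks)) * \<bar>h \<eta> (map \<phi> ks)\<bar>" if "ks \<in> {ks. length ks = J}" for ks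
          using that eta unfolding a_def prod_list_map_divide by (simp add: norm_mult norm_divide norm_power)
      qed
      finally show ?thesis .
    qed
  qed (use p M v in auto)
  obtain T X Y where TXY:
    "\<And>s t. 0 < s \<Longrightarrow> abs_continuous_on {s..t} T"
    "\<And>s t. 0 < s \<Longrightarrow> abs_continuous_on {s..t} X"
    "\<And>s t. 0 < s \<Longrightarrow> abs_continuous_on {s..t} Y"
    "AE x in lborel. x > 0 \<longrightarrow>
        (T has_vector_derivative 4 * (V x / \<eta>) * Y x) (at x) \<and>
        (X has_vector_derivative \<eta> * Y x - 2 * (V x / \<eta>) * Y x) (at x) \<and>
        (Y has_vector_derivative - \<eta> * X x + (V x / \<eta>) * (T x + 2 * X x)) (at x)"
    "\<And>x. 0 \<le> T x" "\<And>x. 4 * ((X x)\<^sup>2 + (Y x)\<^sup>2) \<le> (T x)\<^sup>2" and uT: "\<And>x. (cmod (u x))\<^sup>2 \<le> 2 * T x"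
    by (rule solution_bloch_vector[OF sol[unfolded E] eta]) blast
  have W: "(\<lambda>k. a k * exp (- \<i> * of_real (\<phi> k) * of_real x) * \<gamma> k x) sums of_real (V x / \<eta>)" if "0 < x" for x
    using sums_divide[OF V[OF that], of "of_real \<eta>"] by (simp add: a_def)
  obtain x0 C where x0: "0 < x0" and C: "\<And>x. x0 \<le> x \<Longrightarrow> T x \<le> C"
    using bloch_vector_bounded[OF W TXY] by blast
  have "loc_abs_continuous u" using sol by (auto simp: is_solution_def)
  then have "bounded (u ` {0<..x0})"
    using x0 by (intro abs_continuous_on_Ioc_bounded) (auto simp: loc_abs_continuous_def)
  moreover have "bounded (u ` {x0..})"
    unfolding bounded_iff
  proof (intro exI ballI, elim imageE)
    fix w x assume "w = u x" "x \<in> {x0..}"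
    then have "(norm w)\<^sup>2 \<le> 2 * C" using uT[of x] C[of x] by simp
    then show "norm w \<le> sqrt (2 * C)" by (rule real_le_rsqrt)
  qed
  moreover have "u ` {0<..} \<subseteq> u ` {0<..x0} \<union> u ` {x0..}" by force
  ultimately show "bounded (u ` {0<..})" by (meson bounded_Un bounded_subset)
qed

end
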